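(* Let $d\in\mathbb N$, $\alpha>1/2$, let $\boldsymbol\gamma=\{\gamma_{\mathfrak u}\}_{\mathfrak u\subset\mathbb N}$ be positive weights, and let $n\ge 2$ be an integer. Put $N=\prod_{p\in\mathcal P_n}p$. Then there exists a vector $\boldsymbol z^\star\in\mathbb Z_N^d$ such that the randomised error, for integration of functions from the space $\mathcal H_{d,\alpha,\boldsymbol\gamma}$, of the randomised lattice algorithm $Q^{\mathrm{ran\text{-}pr}}_{d,n,\boldsymbol z^\star}$ satisfies $$ e^{\mathrm{ran}}_{d,\alpha,\boldsymbol\gamma}\big(Q^{\mathrm{ran\text{-}pr}}_{d,n,\boldsymbol z^\star}\big)\le \frac{(C_\lambda\ln n)^{1/2}}{n^{\lambda+1/2}}\,\big[\mu_{d,\alpha,\boldsymbol\gamma}(\lambda)\big]^{\lambda}\qquad\text{for all }\lambda\in[1/2,\alpha), $$ where $C_\lambda>0$ is a constant depending only on $\lambda$. The quantity $\mu_{d,\alpha,\boldsymbol\gamma}(\lambda)$ goes to infinity for $\lambda\to\alpha$. The upper bound is independent of the dimension (i.e., it can be bounded by a quantity not depending on $d$) if the weights are such that $$\sum_{\emptyset\ne\mathfrak u\subset\mathbb N}\gamma_{\mathfrak u}^{1/\lambda}\,(2\zeta(\alpha/\lambda))^{|\mathfrak u|}<\infty,$$ the sum being over finite subsets.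
   Context: Conventions: $\mathbb N=\{1,2,\dots\}$; $\mathbb Z_m$ is identified with $\{0,\dots,m-1\}$; $\equiv_m$ means congruent modulo $m$; $\zeta$ is the Riemann zeta function; for $\boldsymbol h\in\mathbb Z^d$, $\mathrm{supp}(\boldsymbol h)=\{j: h_j\ne0\}$. Weights: $\boldsymbol\gamma=\{\gamma_{\mathfrak u}\}$ is a collection of positive finite numbers indexed by the finite subsets $\mathfrak u\subset\mathbb N$. Weighted Korobov space: for $\alpha>1/2$ put $r_{\alpha,\boldsymbol\gamma}(\boldsymbol h)=\gamma_{\mathrm{supp}(\boldsymbol h)}^{-1}\prod_{j\in\mathrm{supp}(\boldsymbol h)}|h_j|^\alpha$ and $\widehat f(\boldsymbol h)=\int_{[0,1]^d}f(\boldsymbol x)e^{-2\pi \mathrm i\,\boldsymbol h\cdot\boldsymbol x}\,d\boldsymbol x$. Then $\mathcal H_{d,\alpha,\boldsymbol\gamma}=\{f\in L_2([0,1]^d):\|f\|_{d,\alpha,\boldsymbol\gamma}<\infty\}$ with $\|f\|_{d,\alpha,\boldsymbol\gamma}=\big(\sum_{\boldsymbol h\in\mathbb Z^d}r_{\alpha,\boldsymbol\gamma}^2(\boldsymbol h)|\widehat f(\boldsymbol h)|^2\big)^{1/2}$; elements have absolutely convergent Fourier series and are identified with their continuous one-periodic representatives. For $\lambda\in[1/2,\alpha)$: $\mu_{d,\alpha,\boldsymbol\gamma}(\lambda)=\sum_{\boldsymbol h\in\mathbb Z^d\setminus\{\boldsymbol 0\}}r_{\alpha,\boldsymbol\gamma}^{-1/\lambda}(\boldsymbol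 h)=\sum_{\emptyset\ne\mathfrak u\subseteq\{1,\dots,d\}}\gamma_{\mathfrak u}^{1/\lambda}(2\zeta(\alpha/\lambda))^{|\mathfrak u|}$. Integral and lattice rule: $I_d(f)=\int_{[0,1]^d}f(\boldsymbol x)\,d\boldsymbol x$ and, for $\boldsymbol z\in\mathbb Z^d$ and $m\in\mathbb N$, $Q_{d,m,\boldsymbol z}(f)=\frac1m\sum_{k=0}^{m-1}f\big(\frac{k\boldsymbol z\bmod m}{m}\big)$. $\mathcal P_n$ is the set of primes $p$ with $n/2<p\le n$. The randomised algorithm $Q^{\mathrm{ran\text{-}pr}}_{d,n,\boldsymbol z}$ (fixed vector $\boldsymbol z$) draws $p$ uniformly at random from $\mathcal P_n$ and returns $Q_{d,p,\boldsymbol z}(f)$. The randomised error of a randomised algorithm $A$ is $e^{\mathrm{ran}}_{d,\alpha,\boldsymbol\gamma}(A)=\sup_{\|f\|_{d,\alpha,\boldsymbol\gamma}\le1}\mathbb E\big[|A(f)-I_d(f)|\big]$, the expectation being over the random elements of the algorithm. *)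

theory Defs
  imports "HOL-Probability.Probability" "HOL-Computational_Algebra.Primes"
begin

text \<open>
  The dimension is quantified inside the statement, so vectors are not typed by dimension:
  \<open>\<real>\<^sup>d\<close>, \<open>\<int>\<^sup>d\<close> and \<open>[0,1]\<^sup>d\<close> are the extensional function spaces
  \<open>{1..d} \<rightarrow>\<^sub>E A\<close>, with index set \<open>{1..d}\<close>, and \<open>\<real>\<^sup>d\<close> carries the product topology of
  \<open>HOL-Analysis.Function_Topology\<close>. Only the values of an integrand on \<open>\<real>\<^sup>d\<close> matter.
\<close>

type_synonym integrand = "(nat \<Rightarrow> real) \<Rightarrow> complex"

definition real_vecs :: "nat \<Rightarrow> (nat \<Rightarrow> real) set" where
  "real_vecs d = {1..d} \<rightarrow>\<^sub>E UNIV"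

definition int_vecs :: "nat \<Rightarrow> (nat \<Rightarrow> int) set" where
  "int_vecs d = {1..d} \<rightarrow>\<^sub>E UNIV"

definition zero_vec :: "nat \<Rightarrow> (nat \<Rightarrow> int)" where
  "zero_vec d = (\<lambda>j\<in>{1..d}. 0)"

definition cube :: "nat \<Rightarrow> (nat \<Rightarrow> real) measure" where
  "cube d = Pi\<^sub>M {1..d} (\<lambda>_. restrict_space lborel {0..1})"

text \<open>Extensional vectors take the value \<open>undefined\<close> outside \<open>{1..d}\<close>, hence the restriction of
  the support to \<open>{1..d}\<close>.\<close>

definition supp :: "nat \<Rightarrow> (nat \<Rightarrow> int) \<Rightarrow> nat set" where
  "supp d h = {j \<in> {1..d}. h j \<noteq> 0}"

definition positive_weights :: "(nat set \<Rightarrow> real) \<Rightarrow> bool" where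
  "positive_weights \<gamma> \<longleftrightarrow> (\<forall>u. finite u \<and> u \<subseteq> {1..} \<longrightarrow> \<gamma> u > 0)"

definition korobov_r :: "nat \<Rightarrow> real \<Rightarrow> (nat set \<Rightarrow> real) \<Rightarrow> (nat \<Rightarrow> int) \<Rightarrow> real" where
  "korobov_r d \<alpha> \<gamma> h =
     inverse (\<gamma> (supp d h)) * (\<Prod>j\<in>supp d h. \<bar>real_of_int (h j)\<bar> powr \<alpha>)"

definition fourier_coeff :: "nat \<Rightarrow> integrand \<Rightarrow> (nat \<Rightarrow> int) \<Rightarrow> complex" where
  "fourier_coeff d f h =
     (LINT x|cube d. f x *
        exp (- 2 * complex_of_real pi * \<i> * complex_of_real (\<Sum>j\<in>{1..d}. real_of_int (h j) * x j)))"

definition L2_cube :: "nat \<Rightarrow> integrand set" where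
  "L2_cube d =
     {f. f \<in> borel_measurable (cube d) \<and> integrable (cube d) (\<lambda>x. (cmod (f x))\<^sup>2)}"

definition one_periodic :: "nat \<Rightarrow> integrand \<Rightarrow> bool" where
  "one_periodic d f \<longleftrightarrow> (\<forall>x\<in>real_vecs d. \<forall>j\<in>{1..d}. f (x(j := x j + 1)) = f x)"

text \<open>Summability of the nonnegative series is finiteness of the norm. Elements are the continuous
  one-periodic representatives, since lattice rules use point values.\<close>

definition korobov_space :: "nat \<Rightarrow> real \<Rightarrow> (nat set \<Rightarrow> real) \<Rightarrow> integrand set" where
  "korobov_space d \<alpha> \<gamma> =
     {f \<in> L2_cube d. continuous_on (real_vecs d) f \<and> one_periodic d f \<and>
        (\<lambda>h. (korobov_r d \<alpha> \<gamma> h)\<^sup>2 * (cmod (fourier_coeff d f h))\<^sup>2) summable_on int_vecs d}"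

definition korobov_norm :: "nat \<Rightarrow> real \<Rightarrow> (nat set \<Rightarrow> real) \<Rightarrow> integrand \<Rightarrow> real" where
  "korobov_norm d \<alpha> \<gamma> f =
     sqrt (\<Sum>\<^sub>\<infinity>h\<in>int_vecs d. (korobov_r d \<alpha> \<gamma> h)\<^sup>2 * (cmod (fourier_coeff d f h))\<^sup>2)"

text \<open>The series converges for \<open>0 < lam < \<alpha>\<close>, the only range in which it is used.\<close>

definition korobov_mu :: "nat \<Rightarrow> real \<Rightarrow> (nat set \<Rightarrow> real) \<Rightarrow> real \<Rightarrow> real" where
  "korobov_mu d \<alpha> \<gamma> lam =
     (\<Sum>\<^sub>\<infinity>h\<in>int_vecs d - {zero_vec d}. korobov_r d \<alpha> \<gamma> h powr (- 1 / lam))"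

text \<open>Riemann zeta function for real arguments \<open>s > 1\<close>.\<close>

definition real_zeta :: "real \<Rightarrow> real" where
  "real_zeta s = (\<Sum>k. 1 / real (Suc k) powr s)"

definition integral_cube :: "nat \<Rightarrow> integrand \<Rightarrow> complex" where
  "integral_cube d f = (LINT x|cube d. f x)"

definition lattice_rule :: "nat \<Rightarrow> nat \<Rightarrow> (nat \<Rightarrow> int) \<Rightarrow> integrand \<Rightarrow> complex" where
  "lattice_rule d m z f =
     (\<Sum>k<m. f (\<lambda>j\<in>{1..d}. real_of_int ((int k * z j) mod int m) / real m)) / of_nat m"

definition primes_half :: "nat \<Rightarrow> nat set" where
  "primes_half n = {p. prime p \<and> real n / 2 < real p \<and> p \<le> n}"

text \<open>A randomised algorithm (with finitely or countably many outcomes) maps an integrand to the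
  distribution of its output.\<close>

definition ran_lattice_rule :: "nat \<Rightarrow> nat \<Rightarrow> (nat \<Rightarrow> int) \<Rightarrow> integrand \<Rightarrow> complex pmf" where
  "ran_lattice_rule d n z f =
     map_pmf (\<lambda>p. lattice_rule d p z f) (pmf_of_set (primes_half n))"

text \<open>Valued in the extended nonnegative reals, so that neither the expectation nor the supremum
  can silently take a default value.\<close>

definition ran_error ::
  "nat \<Rightarrow> real \<Rightarrow> (nat set \<Rightarrow> real) \<Rightarrow> (integrand \<Rightarrow> complex pmf) \<Rightarrow> ennreal" where
  "ran_error d \<alpha> \<gamma> A =
     (SUP f \<in> {f \<in> korobov_space d \<alpha> \<gamma>. korobov_norm d \<alpha> \<gamma> f \<le> 1}.
        \<integral>\<^sup>+ y. ennreal (cmod (y - integral_cube d f)) \<partial>measure_pmf (A f))"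

definition error_bound ::
  "real \<Rightarrow> nat \<Rightarrow> real \<Rightarrow> (nat set \<Rightarrow> real) \<Rightarrow> nat \<Rightarrow> real \<Rightarrow> real" where
  "error_bound c d \<alpha> \<gamma> n lam =
     sqrt (c * ln (real n)) / real n powr (lam + 1/2) * korobov_mu d \<alpha> \<gamma> lam powr lam"

end

theory Submission
  imports Defs "HOL-Number_Theory.Pocklington"
begin

text \<open>
  For a prime \<open>p\<close> call \<open>z\<close> good if its squared worst-case error \<open>e\<^sup>2(p,z)\<close> is at most
  \<open>(4 \<mu>(lam) / p) powr (2 lam)\<close> for all \<open>lam\<close> at once. Markov's inequality shows that at least half
  of all \<open>z\<close> modulo \<open>p\<close> are good. By Cauchy-Schwarz the randomised error of \<open>z\<close> is at most the
  square root of the sum over \<open>h \<noteq> 0\<close> of \<open>\<omega>\<^sup>2(h) / r\<^sup>2(h)\<close>, where \<open>\<omega>(h)\<close> is the proportion of the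
  primes \<open>p\<close> that divide \<open>h \<cdot> z\<close>. Average this sum over independent uniformly random good residues
  modulo the different \<open>p\<close>. Compared with \<open>e\<^sup>2(p,z)\<close>, the diagonal terms of \<open>\<omega>\<^sup>2(h)\<close> gain a factor
  \<open>1 / card P\<^sub>n\<close> and the others a factor \<open>O(1 / n)\<close>, and Erdos' proof of Bertrand's postulate gives
  \<open>1 / card P\<^sub>n = O(ln n / n)\<close>. The residues that minimise the sum do not depend on \<open>lam\<close>; the Chinese
  remainder theorem combines them into one vector.
\<close>

section \<open>Primes in dyadic intervals\<close>

text \<open>Averaging \<open>e2\<close> over all residues would only give the rate 1/p, because
  every frequency with some coordinate not divisible by p is hit with probability exactly 1/p.
  Restricting to good residues before averaging keeps the exponent 2 lam, at the price of a factor 2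
  in the hitting probabilities. An off-diagonal term spends one of its two probabilities on the
  factor O(1/n) and keeps the other one for the bound on good residues. This fails only for
  frequencies that both primes divide in every coordinate; dividing these by pq shows that their
  total weight is small. The range lam \<ge> 1/2 enters through 2 lam \<ge> 1: the power of a sum
  then dominates the sum of the powers, and n powr (- 2 lam) is at most 1/n. The extra n powr (-
  1/2) and the logarithm in the error bound are the square root of 1 / card P_n. The error formula
  needs pointwise values of Fourier series, whereas the norm controls only coefficients. Hence the
  detour through uniqueness of coefficients, which rests on Stone-Weierstrass on the torus.\<close>

text \<open>Legendre's formula. Passing from \<open>n\<close> to \<open>n + 1\<close> raises
  \<open>n div p ^ i\<close> exactly when \<open>p ^ i\<close> divides \<open>n + 1\<close>, and the
  number of such \<open>i\<close> is the multiplicity of \<open>p\<close> in \<open>n + 1\<close>.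
  The bound \<open>B\<close> cuts off only summands that vanish.\<close>

lemma multiplicity_fact_prime:
  fixes p :: nat
  assumes "prime p" "n < p ^ Suc B"
  shows "multiplicity p (fact n) = (\<Sum>i\<in>{1..B}. n div p ^ i)"
  using assms(2)
proof (induction n)
  case (Suc n)
  have "p > 1" using assms(1) by (rule prime_gt_1_nat)
  have le: "multiplicity p (Suc n) \<le> B"
  proof (rule ccontr)
    assume "\<not> ?thesis"
    then have "p ^ Suc B dvd Suc n" by (intro multiplicity_dvd') simp
    then show False using Suc.prems by (auto dest: dvd_imp_le)
  qed
  have iff: "p ^ i dvd Suc n \<longleftrightarrow> i \<le> multiplicity p (Suc n)" for i
    using \<open>p > 1\<close> by (intro power_dvd_iff_le_multiplicity) auto
  have "(\<Sum>i\<in>{1..B}. Suc n div p ^ i) = (\<Sum>i\<in>{1..B}. n div p ^ i + of_bool (p ^ i dvd Suc n))"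
    by (intro sum.cong) (auto simp: div_Suc mod_eq_0_iff_dvd)
  also have "\<dots> = (\<Sum>i\<in>{1..B}. n div p ^ i) + card {i\<in>{1..B}. p ^ i dvd Suc n}"
    by (simp add: sum.distrib Int_def)
  also have "{i\<in>{1..B}. p ^ i dvd Suc n} = {1..multiplicity p (Suc n)}"
    using le by (auto simp: iff)
  finally show ?case
    using Suc assms(1) by (simp add: prime_elem_multiplicity_mult_distrib del: mult_Suc)
qed (use assms in \<open>auto simp: not_less\<close>)

text \<open>Legendre's formula for the factorials in the binomial. Natural subtraction is safe
  inside the sum because twice a floor never exceeds the floor of the double.\<close>

lemma multiplicity_central_binomial:
  fixes p :: nat
  assumes "prime p" "2 * m < p ^ Suc B"
  shows "multiplicity p ((2 * m) choose m) = (\<Sum>i\<in>{1..B}. (2 * m) div p ^ i - 2 * (m div p ^ i))"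
proof -
  have "fact m * fact m * (2 * m choose m) = (fact (2 * m) :: nat)"
    using binomial_fact_lemma[of m "2 * m"] by (simp add: mult_2)
  then have "multiplicity p (fact (2 * m)) = 2 * multiplicity p (fact m) + multiplicity p (2 * m choose m)"
    using assms(1) by (simp add: prime_elem_multiplicity_mult_distrib flip: \<open>_ = fact (2 * m)\<close>)
  moreover have "multiplicity p (fact (2 * m)) = (\<Sum>i\<in>{1..B}. (2 * m) div p ^ i)"
    using assms by (rule multiplicity_fact_prime)
  moreover have "2 * multiplicity p (fact m) = (\<Sum>i\<in>{1..B}. 2 * (m div p ^ i))"
    using multiplicity_fact_prime[of p m B] assms by (simp add: sum_distrib_left)
  ultimately have "multiplicity p ((2 * m) choose m)
      = (\<Sum>i\<in>{1..B}. (2 * m) div p ^ i) - (\<Sum>i\<in>{1..B}. 2 * (m div p ^ i))"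
    by linarith
  also have "\<dots> = (\<Sum>i\<in>{1..B}. (2 * m) div p ^ i - 2 * (m div p ^ i))"
  proof (rule sum_subtractf_nat[symmetric])
    fix i
    have "2 * (m div p ^ i) * p ^ i \<le> 2 * m"
      by (simp add: div_times_less_eq_dividend)
    then show "2 * (m div p ^ i) \<le> (2 * m) div p ^ i"
      using prime_gt_0_nat[OF assms(1)] by (simp add: less_eq_div_iff_mult_less_eq)
  qed
  finally show ?thesis .
qed

text \<open>Each summand of the multiplicity is 0 or 1, and there are at most \<open>B\<close> of
  them, where \<open>p ^ B \<le> 2 * m\<close>. The third claim is the key observation of Erdos: for
  2m/3 < p \<le> m the two quotients are 2 and 1, so the only summand cancels.\<close>

lemma prime_power_central_binomial_le:
  fixes p :: nat
  assumes "prime p" "m > 0"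
  defines "v \<equiv> multiplicity p ((2 * m) choose m)"
  shows "p ^ v \<le> 2 * m" "2 * m < p ^ 2 \<Longrightarrow> v \<le> 1" "2 * m < p ^ 2 \<Longrightarrow> 2 * m < 3 * p \<Longrightarrow> p \<le> m \<Longrightarrow> v = 0"
    "2 * m < p \<Longrightarrow> v = 0"
proof -
  have "p > 1" using assms(1) by (rule prime_gt_1_nat)
  obtain B where B: "p ^ B \<le> 2 * m" "2 * m < p ^ Suc B"
    using ex_power_ivl1[of p "2 * m"] \<open>p > 1\<close> assms(2) by auto
  have term_le: "(2 * m) div p ^ i - 2 * (m div p ^ i) \<le> 1" for i
  proof -
    have "p ^ i > 0" using \<open>p > 1\<close> by simp
    then have "m < (m div p ^ i + 1) * p ^ i"
      using dividend_less_div_times[of "p ^ i" m] by (simp add: algebra_simps)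
    then have "2 * m < (2 * (m div p ^ i) + 2) * p ^ i" by (simp add: algebra_simps)
    then have "(2 * m) div p ^ i < 2 * (m div p ^ i) + 2"
      using \<open>p ^ i > 0\<close> by (simp add: div_less_iff_less_mult)
    then show ?thesis by simp
  qed
  have v_eq: "v = (\<Sum>i\<in>{1..B}. (2 * m) div p ^ i - 2 * (m div p ^ i))"
    unfolding v_def using assms(1) B(2) by (rule multiplicity_central_binomial)
  also have "\<dots> \<le> (\<Sum>i\<in>{1..B}. 1)"
    by (intro sum_mono term_le)
  finally have "v \<le> B" by simp
  then show "p ^ v \<le> 2 * m"
    using B(1) \<open>p > 1\<close> power_increasing[of v B p] by linarith
  show le1: "v \<le> 1" if "2 * m < p ^ 2"
  proof -
    have "p ^ B < p ^ 2" using B(1) that by linarith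
    then have "B < 2" using \<open>p > 1\<close> power_less_imp_less_exp by blast
    with \<open>v \<le> B\<close> show ?thesis by simp
  qed
  show "v = 0" if "2 * m < p"
  proof -
    have "p ^ B < p ^ 1" using B(1) that by simp
    then have "B < 1" using \<open>p > 1\<close> power_less_imp_less_exp by blast
    with \<open>v \<le> B\<close> show ?thesis by simp
  qed
  show "v = 0" if "2 * m < p ^ 2" "2 * m < 3 * p" "p \<le> m"
  proof -
    have "v = (\<Sum>i\<in>{1..1}. (2 * m) div p ^ i - 2 * (m div p ^ i))"
      unfolding v_def using assms(1) that(1) by (intro multiplicity_central_binomial) (simp_all add: power2_eq_square)
    also have "\<dots> = (2 * m) div p - 2 * (m div p)" by simp
    finally have "v = (2 * m) div p - 2 * (m div p)" .
    moreover have "(2 * m) div p < 3" using that \<open>p > 1\<close> by (simp add: div_less_iff_less_mult)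
    moreover have "m div p \<ge> 1" using that(3) \<open>p > 1\<close> by (simp add: less_eq_div_iff_mult_less_eq)
    ultimately show ?thesis by linarith
  qed
qed

lemma prod_primes_dvd:
  fixes x :: nat
  assumes "finite A" "\<And>p. p \<in> A \<Longrightarrow> prime p" "\<And>p. p \<in> A \<Longrightarrow> p dvd x"
  shows "\<Prod>A dvd x"
  using assms
proof (induction A rule: finite_induct)
  case (insert p A)
  have "coprime p (\<Prod>A)"
    using insert by (intro prod_coprime_right primes_coprime) auto
  with insert show ?case by (simp add: divides_mult)
qed simp

text \<open>An even \<open>n > 2\<close> is not prime and reduces to \<open>n - 1\<close>. For
  \<open>n = 2 * m + 1\<close> the primes above \<open>m + 1\<close> all divide the binomial
  \<open>C\<close>, which occurs twice in a row of sum \<open>2 * 4 ^ m\<close> and hence is at most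
  \<open>4 ^ m\<close>; the induction hypothesis at \<open>m + 1\<close> covers the rest.\<close>

lemma primorial_le: "\<Prod>{p. prime p \<and> p \<le> n} \<le> (4::nat) ^ n"
proof (induction n rule: less_induct)
  case (less n)
  consider "n \<le> 1" | "n = 2" | "n > 2" "even n" | m where "n = 2 * m + 1" "m \<ge> 1"
  proof (cases "odd n")
    case True
    then obtain k where "n = 2 * k + 1" by (elim oddE)
    then show ?thesis using that(1,4) by (cases "k = 0") auto
  qed (use that in fastforce)
  then show ?case
  proof cases
    case 1
    then have "\<not> (prime p \<and> p \<le> n)" for p :: nat using 1 prime_ge_2_nat[of p] by linarith
    then have "{p. prime p \<and> p \<le> n} = {}" by blast
    then show ?thesis by (simp only: prod.empty) simp
  next
    case 2
    then have "prime p \<and> p \<le> n \<longleftrightarrow> p = 2" for p :: nat using prime_ge_2_nat[of p] by auto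
    then show ?thesis using 2 by simp
  next
    case 3
    then have "\<not> prime n" using prime_odd_nat[of n] by blast
    then have "prime p \<and> p \<le> n \<longleftrightarrow> prime p \<and> p \<le> n - 1" for p by (cases "p = n") auto
    then have "{p. prime p \<and> p \<le> n} = {p. prime p \<and> p \<le> n - 1}" by simp
    then have "\<Prod>{p. prime p \<and> p \<le> n} \<le> (4::nat) ^ (n - 1)" using less[of "n - 1"] 3 by simp
    also have "\<dots> \<le> 4 ^ n" by (intro power_increasing) auto
    finally show ?thesis .
  next
    case (4 m)
    define C where "C = (2 * m + 1) choose m"
    have "{p. prime p \<and> p \<le> n} = {p. prime p \<and> p \<le> m + 1} \<union> {p. prime p \<and> m + 1 < p \<and> p \<le> n}"
      using 4 by auto
    then have "\<Prod>{p. prime p \<and> p \<le> n} = \<Prod>{p. prime p \<and> p \<le> m + 1} * \<Prod>{p. prime p \<and> m + 1 < p \<and> p \<le> n}"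
      by (simp add: prod.union_disjoint disjoint_iff)
    moreover have "\<Prod>{p. prime p \<and> p \<le> m + 1} \<le> (4::nat) ^ (m + 1)"
      using less[of "m + 1"] 4 by simp
    moreover have "\<Prod>{p. prime p \<and> m + 1 < p \<and> p \<le> n} \<le> (4::nat) ^ m"
    proof -
      have "p dvd C" if "prime p" "m + 1 < p" "p \<le> n" for p
      proof -
        have "fact m * fact (m + 1) * C = (fact n :: nat)"
          using binomial_fact_lemma[of m n] 4 unfolding C_def by simp
        then have "p dvd fact m * fact (m + 1) * C"
          using that by (simp add: prime_dvd_fact_iff)
        then show ?thesis using that by (simp add: prime_dvd_mult_iff prime_dvd_fact_iff del: fact_Suc)
      qed
      then have "\<Prod>{p. prime p \<and> m + 1 < p \<and> p \<le> n} dvd C"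
        by (intro prod_primes_dvd) auto
      moreover have "C > 0" unfolding C_def by simp
      ultimately have "\<Prod>{p. prime p \<and> m + 1 < p \<and> p \<le> n} \<le> C" by (simp add: dvd_imp_le)
      also have "C \<le> 4 ^ m"
      proof -
        have "C + ((2 * m + 1) choose (m + 1)) = (\<Sum>k\<in>{m, m + 1}. (2 * m + 1) choose k)"
          by (simp add: C_def)
        also have "\<dots> \<le> (\<Sum>k\<le>2 * m + 1. (2 * m + 1) choose k)"
          by (intro sum_mono2) auto
        also have "\<dots> = 2 ^ (2 * m + 1)" by (rule choose_row_sum)
        also have "\<dots> = 2 * 4 ^ m" by (simp add: power_mult)
        finally show ?thesis
          using binomial_symmetric[of m "2 * m + 1"] by (simp add: C_def del: binomial_Suc_Suc)
      qed
      finally show ?thesis .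
    qed
    ultimately have "\<Prod>{p. prime p \<and> p \<le> n} \<le> (4::nat) ^ (m + 1) * 4 ^ m"
      by (simp add: mult_mono)
    also have "\<dots> = 4 ^ n" using 4 by (simp flip: power_add add: mult_2)
    finally show ?thesis .
  qed
qed



text \<open>The prime factors split into three ranges: p^2 \<le> 2m, where a prime power is at most
  2m; p \<le> 2m/3 with exponent at most 1, bounded by the primorial; and m < p. Nothing lies
  between 2m/3 and m. The first two ranges may overlap, which is harmless because all factors are at
  least 1.\<close>

lemma central_binomial_le_primes:
  assumes "m > 0"
  shows "(2 * m) choose m \<le> (2 * m) ^ card {p. prime p \<and> p ^ 2 \<le> 2 * m} * 4 ^ ((2 * m) div 3) *
           (2 * m) ^ card {p. prime p \<and> m < p \<and> p \<le> 2 * m}"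
proof -
  define C where "C = (2 * m) choose m"
  define S where "S = {p::nat. prime p \<and> p \<le> 2 * m}"
  have fin [simp]: "finite S" unfolding S_def by simp
  have distr: "(\<Prod>p\<in>S. (if P p then k else 1) * (if Q p then p else 1) * (if R p then k else 1)) =
      (\<Prod>p\<in>{p\<in>S. P p}. k) * (\<Prod>p\<in>{p\<in>S. Q p}. p) * (\<Prod>p\<in>{p\<in>S. R p}. k)" for P Q R k
    by (simp only: prod.distrib prod.inter_filter[OF fin])
  have "C > 0" unfolding C_def by simp
  have "C = (\<Prod>p\<in>prime_factors C. p ^ multiplicity p C)"
    using \<open>C > 0\<close> by (rule prime_factorization_nat)
  also have "\<dots> = (\<Prod>p\<in>S. p ^ multiplicity p C)"
  proof (rule prod.mono_neutral_left)
    show "prime_factors C \<subseteq> S"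
    proof
      fix p assume p: "p \<in> prime_factors C"
      then have "prime p" "multiplicity p C > 0" by (auto simp: prime_factors_multiplicity)
      then show "p \<in> S"
        using prime_power_central_binomial_le(4)[of p m] assms unfolding C_def S_def by fastforce
    qed
    show "\<forall>i\<in>S - prime_factors C. i ^ multiplicity i C = 1"
      by (auto simp: S_def prime_factors_multiplicity)
  qed simp
  also have "\<dots> \<le> (\<Prod>p\<in>S. (if p ^ 2 \<le> 2 * m then 2 * m else 1) *
      (if p \<le> (2 * m) div 3 then p else 1) * (if m < p then 2 * m else 1))"
  proof (intro prod_mono conjI)
    fix p assume "p \<in> S"
    then have p: "prime p" "p \<le> 2 * m" by (auto simp: S_def)
    then have "p > 0" by (simp add: prime_gt_0_nat)
    note * = prime_power_central_binomial_le[OF p(1) assms, folded C_def]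
    have third: "p \<le> (2 * m) div 3 \<longleftrightarrow> \<not> 2 * m < 3 * p" by auto
    consider "p ^ 2 \<le> 2 * m" | "2 * m < p ^ 2" "m < p"
      | "2 * m < p ^ 2" "p \<le> m" "2 * m < 3 * p" | "2 * m < p ^ 2" "p \<le> m" "\<not> 2 * m < 3 * p"
      by linarith
    then show "p ^ multiplicity p C \<le> (if p ^ 2 \<le> 2 * m then 2 * m else 1) *
      (if p \<le> (2 * m) div 3 then p else 1) * (if m < p then 2 * m else 1)"
    proof cases
      case 1
      then have "p ^ multiplicity p C \<le> 2 * m * 1 * 1" using * by simp
      also have "\<dots> \<le> (if p ^ 2 \<le> 2 * m then 2 * m else 1) *
          (if p \<le> (2 * m) div 3 then p else 1) * (if m < p then 2 * m else 1)"
        using 1 \<open>p > 0\<close> assms by (intro mult_mono) auto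
      finally show ?thesis .
    next
      case 2
      then show ?thesis using *(1) by (simp add: third)
    next
      case 3
      then show ?thesis using *(3) by (simp add: third)
    next
      case 4
      then have "p ^ multiplicity p C \<le> p ^ 1" using * \<open>p > 0\<close> by (intro power_increasing) auto
      with 4 show ?thesis by (simp add: third)
    qed
  qed simp
  also have "\<dots> = (\<Prod>p\<in>{p\<in>S. p ^ 2 \<le> 2 * m}. 2 * m) * (\<Prod>p\<in>{p\<in>S. p \<le> (2 * m) div 3}. p) *
      (\<Prod>p\<in>{p\<in>S. m < p}. 2 * m)"
    by (rule distr)
  also have "{p\<in>S. p ^ 2 \<le> 2 * m} = {p. prime p \<and> p ^ 2 \<le> 2 * m}"
  proof -
    have "p \<le> 2 * m" if "p ^ 2 \<le> 2 * m" for p :: nat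
      using that by (rule order_trans[rotated]) (simp add: power2_eq_square)
    then show ?thesis unfolding S_def by blast
  qed
  also have "{p\<in>S. m < p} = {p. prime p \<and> m < p \<and> p \<le> 2 * m}"
    unfolding S_def by auto
  also have "{p\<in>S. p \<le> (2 * m) div 3} = {p. prime p \<and> p \<le> (2 * m) div 3}"
    unfolding S_def by auto
  finally have "C \<le> (2 * m) ^ card {p. prime p \<and> p ^ 2 \<le> 2 * m} *
      \<Prod>{p. prime p \<and> p \<le> (2 * m) div 3} * (2 * m) ^ card {p. prime p \<and> m < p \<and> p \<le> 2 * m}"
    by (simp only: prod_constant)
  also have "\<dots> \<le> (2 * m) ^ card {p. prime p \<and> p ^ 2 \<le> 2 * m} * 4 ^ ((2 * m) div 3) *
      (2 * m) ^ card {p. prime p \<and> m < p \<and> p \<le> 2 * m}"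
    by (intro mult_mono le_refl primorial_le) auto
  finally show ?thesis unfolding C_def .
qed

text \<open>Taking logarithms in \<open>central_binomial_le_primes\<close> against the lower bound
  4^m / (2m) leaves a main term of y ln 2 (1 - 2/3), where y = 2m, minus an error of order sqrt y ln
  y. The threshold 8192 makes the error smaller than y/10.\<close>

lemma card_primes_dyadic_ge:
  assumes "m \<ge> 8192"
  shows "real (2 * m) / 10 \<le> ln (real (2 * m)) * real (card {p. prime p \<and> m < p \<and> p \<le> 2 * m})"
proof -
  define y where "y = real (2 * m)"
  define L where "L = card {p. prime p \<and> m < p \<and> p \<le> 2 * m}"
  define A where "A = {p::nat. prime p \<and> p ^ 2 \<le> 2 * m}"
  have y: "y \<ge> 16384" using assms unfolding y_def by simp
  have "real (card A) \<le> sqrt y"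
  proof -
    have "p \<le> nat \<lfloor>sqrt y\<rfloor>" if "p \<in> A" for p
    proof -
      have "real p ^ 2 \<le> y" using that unfolding A_def y_def by (metis (mono_tags, lifting) mem_Collect_eq of_nat_le_iff of_nat_power)
      then show ?thesis by (simp add: le_nat_floor real_le_rsqrt)
    qed
    then have "A \<subseteq> {1..nat \<lfloor>sqrt y\<rfloor>}"
      using prime_ge_1_nat by (auto simp: A_def)
    then have "real (card A) \<le> real (nat \<lfloor>sqrt y\<rfloor>)" by (metis of_nat_le_iff card_atLeastAtMost card_mono diff_Suc_1 finite_atLeastAtMost)
    also have "real (nat \<lfloor>sqrt y\<rfloor>) \<le> sqrt y" using y by (intro of_nat_floor) simp
    finally show ?thesis by simp
  qed
  moreover have "ln y \<ge> 0" using y by simp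
  ultimately have A: "real (card A) * ln y \<le> sqrt y * ln y" by (intro mult_right_mono)
  have "4 ^ m / y \<le> real ((2 * m) choose m)"
    using central_binomial_lower_bound[of m] assms by (simp add: y_def)
  also have "\<dots> \<le> real ((2 * m) ^ card A * 4 ^ ((2 * m) div 3) * (2 * m) ^ L)"
    unfolding A_def L_def using assms by (intro of_nat_mono central_binomial_le_primes) simp
  also have "\<dots> = y ^ card A * 4 ^ ((2 * m) div 3) * y ^ L" by (simp add: y_def)
  finally have "ln (4 ^ m / y) \<le> ln (y ^ card A * 4 ^ ((2 * m) div 3) * y ^ L)"
    using y by (subst ln_le_cancel_iff) auto
  then have "real m * ln 4 - ln y \<le> real (card A) * ln y + real ((2 * m) div 3) * ln 4 + real L * ln y"
    using y by (simp add: ln_div ln_mult ln_realpow)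
  also have "real ((2 * m) div 3) * ln 4 \<le> (y / 3) * ln 4"
    unfolding y_def by (intro mult_right_mono) (linarith, simp)
  finally have "(y / 2) * ln 4 - ln y \<le> sqrt y * ln y + (y / 3) * ln 4 + real L * ln y"
    using A by (simp add: y_def)
  moreover have "ln (4::real) = 2 * ln 2" using ln_realpow[of 2 2] by simp
  ultimately have main: "y * ln 2 / 3 - (sqrt y + 1) * ln y \<le> real L * ln y"
    by (simp add: field_simps)
  \<comment> \<open>Normalising y as 2^14 s^2 with s \<ge> 1 turns both sqrt y and ln y into linear
    bounds in s, since 14 ln 2 < 10. The error is then at most 1290 s^2, below y/10.\<close>
  define s where "s = sqrt (y / 16384)"
  have s: "s \<ge> 1" using y unfolding s_def by simp
  have ys: "y = 16384 * s ^ 2" using y unfolding s_def by simp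
  have sq: "sqrt y = 128 * s"
    unfolding ys using s by (simp add: real_sqrt_mult real_sqrt_eq_iff)
  have ln16: "ln (16384::real) = 14 * ln 2" using ln_realpow[of 2 14] by simp
  have "ln y = 14 * ln 2 + 2 * ln s"
    unfolding ys using s by (simp add: ln_mult ln_realpow ln16)
  also have "\<dots> \<le> 14 * (25 / 36) + 2 * (s - 1)"
    using ln2_le_25_over_36 ln_le_minus_one[of s] s by simp
  also have "\<dots> \<le> 10 * s" using s by simp
  finally have "(sqrt y + 1) * ln y \<le> (129 * s) * (10 * s)"
    using s \<open>ln y \<ge> 0\<close> unfolding sq by (intro mult_mono) auto
  also have "\<dots> \<le> y * (1 / 10)" unfolding ys using s by (simp add: power2_eq_square)
  finally have "(sqrt y + 1) * ln y \<le> y * (1 / 10)" .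
  moreover have "y * ln 2 / 3 \<ge> y * (2 / 9)" using ln2_ge_two_thirds y by simp
  ultimately have "y / 10 \<le> real L * ln y" using main y by linarith
  then show ?thesis unfolding y_def L_def by (simp add: mult.commute)
qed

section \<open>Primes for small n, and the prime count for all n\<close>

text \<open>Trial division below \<open>k\<close>, where \<open>k\<close> exceeds the square root of
  \<open>p\<close>. The range is an explicit list so that unfolding with \<open>upt_rec\<close>
  decides concrete cases.\<close>

lemma prime_nat_sqrtI:
  fixes p :: nat
  assumes "1 < p" "p < k * k" "\<forall>n\<in>set [2..<k]. \<not> n dvd p"
  shows "prime p"
proof -
  have "d = 1" if "d dvd p" "d\<^sup>2 \<le> p" for d
  proof (rule ccontr)
    assume "d \<noteq> 1"
    moreover have "d \<noteq> 0" using that(1) assms(1) by (intro notI) simp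
    moreover have "d < k"
      using that(2) assms(2) mult_le_mono[of k d k d] by (auto simp: power2_eq_square intro: ccontr)
    ultimately show False using assms(3) that(1) by auto
  qed
  then show ?thesis using assms(1) prime_divisor_sqrt[of p] by auto
qed

lemma finite_primes_half [simp]: "finite (primes_half n)"
  by (rule finite_subset[of _ "{..n}"]) (auto simp: primes_half_def)

text \<open>A prime \<open>p \<le> n\<close> outside \<open>primes_half n\<close> forces
  \<open>2 * p \<le> n\<close>. Each prime of the chain 2, 3, 5, ..., 9973 is at most twice its
  predecessor, so emptiness pushes \<open>n\<close> along the whole chain up to 19946 = 2 *
  9973.\<close>

lemma primes_half_nonempty_small:
  assumes "2 \<le> n" "n < 19946"
  shows "primes_half n \<noteq> {}"
proof
  assume empty: "primes_half n = {}"
  have primes1: "prime (2::nat)" "prime (3::nat)" "prime (5::nat)" "prime (7::nat)"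
    by simp_all
  have primes2: "prime (13::nat)" "prime (23::nat)" "prime (43::nat)" "prime (83::nat)"
    by (rule prime_nat_sqrtI[of _ 10]; simp add: upt_rec)+
  have primes3: "prime (163::nat)" "prime (317::nat)" "prime (631::nat)" "prime (1259::nat)"
    by (rule prime_nat_sqrtI[of _ 40]; simp add: upt_rec)+
  have primes4: "prime (2503::nat)" "prime (5003::nat)" "prime (9973::nat)"
    by (rule prime_nat_sqrtI[of _ 101]; simp add: upt_rec)+
  note primes = primes1 primes2 primes3 primes4
  have step: "2 * p \<le> n" if "prime p" "p \<le> n" for p :: nat
  proof (rule ccontr)
    assume "\<not> 2 * p \<le> n"
    then have "real n / 2 < real p" by linarith
    then have "p \<in> primes_half n" using that unfolding primes_half_def by simp
    with empty show False by simp
  qed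
  have "4 \<le> n" using step[OF primes(1)] assms(1) by linarith
  have "6 \<le> n" using step[OF primes(2)] \<open>4 \<le> n\<close> by linarith
  have "10 \<le> n" using step[OF primes(3)] \<open>6 \<le> n\<close> by linarith
  have "14 \<le> n" using step[OF primes(4)] \<open>10 \<le> n\<close> by linarith
  have "26 \<le> n" using step[OF primes(5)] \<open>14 \<le> n\<close> by linarith
  have "46 \<le> n" using step[OF primes(6)] \<open>26 \<le> n\<close> by linarith
  have "86 \<le> n" using step[OF primes(7)] \<open>46 \<le> n\<close> by linarith
  have "166 \<le> n" using step[OF primes(8)] \<open>86 \<le> n\<close> by linarith
  have "326 \<le> n" using step[OF primes(9)] \<open>166 \<le> n\<close> by linarith
  have "634 \<le> n" using step[OF primes(10)] \<open>326 \<le> n\<close> by linarith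
  have "1262 \<le> n" using step[OF primes(11)] \<open>634 \<le> n\<close> by linarith
  have "2518 \<le> n" using step[OF primes(12)] \<open>1262 \<le> n\<close> by linarith
  have "5006 \<le> n" using step[OF primes(13)] \<open>2518 \<le> n\<close> by linarith
  have "10006 \<le> n" using step[OF primes(14)] \<open>5006 \<le> n\<close> by linarith
  have "19946 \<le> n" using step[OF primes(15)] \<open>10006 \<le> n\<close> by linarith
  with assms(2) show False by simp
qed

text \<open>The constant 30000 is dictated by small \<open>n\<close>: a single prime together with
  \<open>ln n \<ge> 2/3\<close> already gives 20000, above the threshold 16386. For larger
  \<open>n\<close> the dyadic bound at \<open>n div 2\<close> leaves ample room, also for odd
  \<open>n\<close>.\<close>

lemma card_primes_half_ge:
  assumes "n \<ge> 2"
  shows "real n \<le> 30000 * ln (real n) * real (card (primes_half n))"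
proof (cases "n < 16386")
  case True
  then have "card (primes_half n) \<ge> 1"
    using primes_half_nonempty_small[of n] assms by (simp add: Suc_le_eq card_gt_0_iff)
  moreover have "ln (real n) \<ge> 2 / 3"
    using ln2_ge_two_thirds assms ln_le_cancel_iff[of 2 "real n"] by linarith
  ultimately have "30000 * (2 / 3) * 1 \<le> 30000 * ln (real n) * real (card (primes_half n))"
    by (intro mult_mono) auto
  then show ?thesis using True by simp
next
  case False
  define m where "m = n div 2"
  have m: "m \<ge> 8192" using False unfolding m_def by simp
  have "{p. prime p \<and> m < p \<and> p \<le> 2 * m} \<subseteq> primes_half n"
    unfolding primes_half_def m_def by auto
  then have "card {p. prime p \<and> m < p \<and> p \<le> 2 * m} \<le> card (primes_half n)"
    by (intro card_mono) auto
  then have "ln (real (2 * m)) * real (card {p. prime p \<and> m < p \<and> p \<le> 2 * m})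
      \<le> ln (real n) * real (card (primes_half n))"
    using m unfolding m_def by (intro mult_mono) auto
  then have "real (2 * m) / 10 \<le> ln (real n) * real (card (primes_half n))"
    using card_primes_dyadic_ge[OF m] by linarith
  moreover have "real n \<le> 2 * real (2 * m)" using m unfolding m_def by linarith
  moreover have "0 \<le> ln (real n) * real (card (primes_half n))" using assms by simp
  ultimately show ?thesis by linarith
qed

section \<open>Fourier series of continuous periodic functions\<close>

definition fchar :: "nat \<Rightarrow> (nat \<Rightarrow> int) \<Rightarrow> (nat \<Rightarrow> real) \<Rightarrow> complex" where
  "fchar d h x = cis (2 * pi * (\<Sum>j\<in>{1..d}. real_of_int (h j) * x j))"

lemma norm_fchar [simp]: "cmod (fchar d h x) = 1"
  by (simp add: fchar_def)

lemma fchar_mult: "fchar d h x * fchar d k x = fchar d (\<lambda>j. h j + k j) x"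
  by (simp add: fchar_def cis_mult algebra_simps sum.distrib)

lemma cnj_fchar: "cnj (fchar d h x) = fchar d (\<lambda>j. - h j) x"
  by (simp add: fchar_def cis_cnj sum_negf)

lemma fchar_cong: "(\<And>j. j \<in> {1..d} \<Longrightarrow> h j = k j) \<Longrightarrow> fchar d h x = fchar d k x"
  unfolding fchar_def by (intro arg_cong[of _ _ "\<lambda>t. cis (2 * pi * t)"] sum.cong) auto

lemma fchar_eq_prod: "fchar d h x = (\<Prod>j\<in>{1..d}. cis (2 * pi * real_of_int (h j) * x j))"
proof -
  have "cis (sum g A) = (\<Prod>j\<in>A. cis (g j))" if "finite A" for g and A :: "nat set"
    using that by (induction A rule: finite_induct) (auto simp: cis_mult[symmetric])
  from this[of "{1..d}" "\<lambda>j. 2 * pi * real_of_int (h j) * x j"] show ?thesis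
    by (simp add: fchar_def sum_distrib_left mult.assoc)
qed

lemma fourier_coeff_fchar: "fourier_coeff d f h = (LINT x|cube d. f x * cnj (fchar d h x))"
proof -
  have "exp (- 2 * complex_of_real pi * \<i> * complex_of_real t) = cnj (cis (2 * pi * t))" for t
    unfolding cis_cnj by (simp add: cis_conv_exp mult_ac)
  then show ?thesis unfolding fourier_coeff_def fchar_def by (simp only:)
qed

lemma continuous_on_coordinate: "continuous_on S (\<lambda>x::nat \<Rightarrow> 'b::topological_space. x j)"
  by (rule continuous_on_product_then_coordinatewise[OF continuous_on_id])

lemma continuous_on_cis_real: "continuous_on S g \<Longrightarrow> continuous_on S (\<lambda>x. cis (g x))"
  unfolding cis_conv_exp by (intro continuous_intros)

lemma continuous_on_fchar: "continuous_on S (fchar d h)"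
  unfolding fchar_def[abs_def]
  by (intro continuous_on_cis_real continuous_on_mult continuous_on_const continuous_on_sum
      continuous_on_coordinate)

lemma cis_2pi_add_int: "cis (2 * pi * (t + real_of_int k)) = cis (2 * pi * t)"
proof -
  have "cis (2 * pi * (t + real_of_int k)) = cis (2 * pi * t) * cis (2 * pi * real_of_int k)"
    by (simp add: cis_mult algebra_simps)
  then show ?thesis by (simp add: cis_multiple_2pi)
qed

lemma one_periodic_fchar: "one_periodic d (fchar d h)"
  unfolding one_periodic_def
proof (intro ballI)
  fix x :: "nat \<Rightarrow> real" and j assume j: "j \<in> {1..d}"
  have "(\<Sum>i\<in>{1..d}. real_of_int (h i) * (x(j := x j + 1)) i)
      = (\<Sum>i\<in>{1..d}. real_of_int (h i) * x i + (if i = j then real_of_int (h j) else 0))"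
    by (intro sum.cong) (auto simp: algebra_simps)
  also have "\<dots> = (\<Sum>i\<in>{1..d}. real_of_int (h i) * x i) + real_of_int (h j)"
    using j by (simp add: sum.distrib)
  finally show "fchar d h (x(j := x j + 1)) = fchar d h x"
    by (simp add: fchar_def cis_2pi_add_int del: fun_upd_apply)
qed

abbreviation unit_interval :: "real measure" where
  "unit_interval \<equiv> restrict_space lborel {0..1}"

lemma prob_space_unit_interval: "prob_space unit_interval"
  by (rule prob_spaceI) (simp add: emeasure_restrict_space space_restrict_space)

lemma product_sigma_finite_unit_interval: "product_sigma_finite (\<lambda>_::nat. unit_interval)"
  by (intro product_sigma_finite.intro prob_space_imp_sigma_finite prob_space_unit_interval)

lemma prob_space_cube: "prob_space (cube d)"
  unfolding cube_def by (rule prob_space_PiM) (rule prob_space_unit_interval)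

lemma space_cube: "space (cube d) = {1..d} \<rightarrow>\<^sub>E {0..1}"
  by (simp add: cube_def space_PiM space_restrict_space)

lemma cube_subset_real_vecs: "{1..d} \<rightarrow>\<^sub>E {0..1} \<subseteq> real_vecs d"
  by (auto simp: real_vecs_def)

lemma measurable_cube_coordinate [measurable]:
  "j \<in> {1..d} \<Longrightarrow> (\<lambda>x. x j) \<in> borel_measurable (cube d)"
  unfolding cube_def
  by (rule measurable_compose[OF measurable_component_singleton]) (auto intro: measurable_restrict_space1)

lemma measurable_fchar [measurable]: "fchar d h \<in> borel_measurable (cube d)"
proof -
  have "(\<lambda>x. 2 * pi * (\<Sum>j\<in>{1..d}. real_of_int (h j) * x j)) \<in> borel_measurable (cube d)"
    by (intro borel_measurable_times borel_measurable_sum measurable_cube_coordinate) auto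
  then show ?thesis
    unfolding fchar_def[abs_def] by (rule measurable_compose) (auto intro!: borel_measurable_continuous_onI continuous_intros)
qed

lemma integrable_cube_bounded:
  fixes f :: "_ \<Rightarrow> 'b::{banach,second_countable_topology}"
  assumes "f \<in> borel_measurable (cube d)" "\<And>x. x \<in> {1..d} \<rightarrow>\<^sub>E {0..1} \<Longrightarrow> norm (f x) \<le> B"
  shows "integrable (cube d) f"
proof -
  interpret prob_space "cube d" by (rule prob_space_cube)
  show ?thesis using assms by (intro integrable_const_bound[of _ B]) (auto simp: space_cube)
qed

lemma norm_integral_cube_le:
  fixes f :: "_ \<Rightarrow> 'b::{banach,second_countable_topology}"
  assumes "f \<in> borel_measurable (cube d)" "\<And>x. x \<in> {1..d} \<rightarrow>\<^sub>E {0..1} \<Longrightarrow> norm (f x) \<le> B"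
  shows "norm (LINT x|cube d. f x) \<le> B"
proof -
  interpret prob_space "cube d" by (rule prob_space_cube)
  have "norm (LINT x|cube d. f x) \<le> (LINT x|cube d. norm (f x))" by (rule integral_norm_bound)
  also have "\<dots> \<le> (LINT x|cube d. B)"
    using integrable_cube_bounded[OF assms] assms(2) by (intro integral_mono) (auto simp: space_cube)
  finally show ?thesis by (simp add: prob_space)
qed

lemma integral_unit_interval_cis:
  "(LINT t|unit_interval. cis (2 * pi * real_of_int k * t)) = of_bool (k = 0)"
proof (cases "k = 0")
  case True
  interpret prob_space unit_interval by (rule prob_space_unit_interval)
  show ?thesis using True prob_space by simp
next
  case False
  define c where "c = 2 * pi * real_of_int k"
  have "c \<noteq> 0" using False unfolding c_def by simp
  have "(LINT t|unit_interval. cis (c * t)) = (LINT t|lborel. indicator {0..1} t *\<^sub>R cis (c * t))"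
    by (intro integral_restrict_space) simp
  also have "\<dots> = - \<i> * cis (c * 1) / c - (- \<i> * cis (c * 0) / c)"
  proof (rule integral_FTC_atLeastAtMost)
    fix t :: real
    have "((\<lambda>z. - \<i> * exp (\<i> * (complex_of_real c * z)) / c) has_field_derivative exp (\<i> * (complex_of_real c * complex_of_real t)))
        (at (complex_of_real t))"
      using \<open>c \<noteq> 0\<close> by (auto intro!: derivative_eq_intros)
    then show "((\<lambda>t. - \<i> * cis (c * t) / c) has_vector_derivative cis (c * t)) (at t within {0..1})"
      unfolding cis_conv_exp of_real_mult by (rule has_vector_derivative_real_field)
  qed (auto intro!: continuous_intros continuous_on_cis_real)
  also have "\<dots> = 0" using cis_2pi_add_int[of 0 k] by (simp add: c_def)
  finally show ?thesis using False by (simp add: c_def)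
qed

lemma integral_fchar: "(LINT x|cube d. fchar d h x) = of_bool (\<forall>j\<in>{1..d}. h j = 0)"
proof -
  have int: "integrable unit_interval (\<lambda>t. cis (2 * pi * real_of_int k * t))" for k
  proof -
    interpret prob_space unit_interval by (rule prob_space_unit_interval)
    show ?thesis
      by (rule integrable_const_bound[of _ 1])
        (auto intro!: measurable_restrict_space1 borel_measurable_continuous_onI continuous_intros continuous_on_cis_real)
  qed
  have "(LINT x|cube d. fchar d h x) = (\<Prod>j\<in>{1..d}. LINT t|unit_interval. cis (2 * pi * real_of_int (h j) * t))"
    unfolding fchar_eq_prod cube_def
    by (rule product_sigma_finite.product_integral_prod[OF product_sigma_finite_unit_interval]) (simp_all add: int)
  also have "\<dots> = of_bool (\<forall>j\<in>{1..d}. h j = 0)"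
    unfolding integral_unit_interval_cis by (cases "\<forall>j\<in>{1..d}. h j = 0") auto
  finally show ?thesis .
qed

section \<open>Density of trigonometric polynomials\<close>

text \<open>The linear span of the characters, given by closure rules so that measurability,
  boundedness, orthogonality and closure under products all follow by rule induction.\<close>

inductive_set trig_polys :: "nat \<Rightarrow> integrand set" for d where
  "fchar d h \<in> trig_polys d"
| "T \<in> trig_polys d \<Longrightarrow> (\<lambda>x. c * T x) \<in> trig_polys d"
| "T \<in> trig_polys d \<Longrightarrow> U \<in> trig_polys d \<Longrightarrow> (\<lambda>x. T x + U x) \<in> trig_polys d"

lemma trig_polys_mult:
  assumes "T \<in> trig_polys d" "U \<in> trig_polys d"
  shows "(\<lambda>x. T x * U x) \<in> trig_polys d"
  using assms(1)
proof induction
  case (1 h)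
  show ?case using assms(2)
  proof induction
    case (1 k)
    then show ?case using trig_polys.intros(1)[of d "\<lambda>j. h j + k j"] by (simp add: fchar_mult[abs_def])
  next
    case (2 T c)
    then show ?case using trig_polys.intros(2)[of "\<lambda>x. fchar d h x * T x" d c] by (simp add: mult_ac)
  next
    case (3 T U)
    then show ?case using trig_polys.intros(3) by (fastforce simp: distrib_left)
  qed
next
  case (2 T c)
  then show ?case using trig_polys.intros(2)[of "\<lambda>x. T x * U x" d c] by (simp add: mult_ac)
next
  case (3 T V)
  then show ?case using trig_polys.intros(3) by (fastforce simp: distrib_right)
qed

lemma measurable_trig_polys: "T \<in> trig_polys d \<Longrightarrow> T \<in> borel_measurable (cube d)"
  by (induction rule: trig_polys.induct) auto

lemma trig_polys_const: "(\<lambda>_. c) \<in> trig_polys d"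
  using trig_polys.intros(2)[OF trig_polys.intros(1)[of d "\<lambda>_. 0"], of c] by (simp add: fchar_def)

lemma trig_polys_bounded: "T \<in> trig_polys d \<Longrightarrow> \<exists>B. \<forall>x. cmod (T x) \<le> B"
proof (induction rule: trig_polys.induct)
  case (2 T c)
  then obtain B where "\<And>x. cmod (T x) \<le> B" by blast
  then have "\<forall>x. cmod (c * T x) \<le> cmod c * B" by (simp add: norm_mult mult_left_mono)
  then show ?case by blast
next
  case (3 T U)
  then obtain B B' where "\<And>x. cmod (T x) \<le> B" "\<And>x. cmod (U x) \<le> B'" by blast
  then have "\<forall>x. cmod (T x + U x) \<le> B + B'" by (meson norm_triangle_mono)
  then show ?case by blast
qed (auto intro: exI[of _ 1])


text \<open>Periodicity is stated for one coordinate at a time. Shifting a whole set of coordinates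
  is what identifies opposite faces of the cube, where several coordinates may equal 1 at
  once.\<close>

lemma one_periodic_restrict_add:
  assumes "one_periodic d f" "x \<in> real_vecs d" "A \<subseteq> {1..d}"
  shows "f (\<lambda>j\<in>{1..d}. if j \<in> A then x j + 1 else x j) = f x"
proof -
  have "finite A" using assms(3) by (rule finite_subset) simp
  then show ?thesis using assms(3)
  proof (induction A rule: finite_induct)
    case empty
    have "(\<lambda>j\<in>{1..d}. x j) = x" using assms(2) by (auto simp: real_vecs_def PiE_iff extensional_def)
    then show ?case by simp
  next
    case (insert a A)
    let ?y = "\<lambda>j\<in>{1..d}. if j \<in> A then x j + 1 else x j"
    have "(\<lambda>j\<in>{1..d}. if j \<in> insert a A then x j + 1 else x j) = ?y(a := ?y a + 1)"
      using insert by (auto simp: fun_eq_iff)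
    moreover have "?y \<in> real_vecs d" by (auto simp: real_vecs_def)
    ultimately have "f (\<lambda>j\<in>{1..d}. if j \<in> insert a A then x j + 1 else x j) = f ?y"
      using assms(1) insert.prems unfolding one_periodic_def by (simp del: fun_upd_apply restrict_apply)
    also have "\<dots> = f x" using insert by blast
    finally show ?case .
  qed
qed

text \<open>The topology is that of functions on all naturals. An extensional product is a full
  product with the singleton of \<open>undefined\<close> as factor outside \<open>{1..d}\<close>, so
  Tychonoff's theorem applies.\<close>

lemma compact_cube: "compact (({1..d::nat} \<rightarrow>\<^sub>E {0..1}) :: (nat \<Rightarrow> real) set)"
  and compact_torus: "compact (({1..d::nat} \<rightarrow>\<^sub>E sphere 0 1) :: (nat \<Rightarrow> complex) set)"
proof -
  have *: "compact ({1..d::nat} \<rightarrow>\<^sub>E K)" if "compact K" for K :: "'b::topological_space set"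
  proof -
    have "{1..d} \<rightarrow>\<^sub>E K = (\<Pi>\<^sub>E i\<in>UNIV. if i \<in> {1..d} then K else {undefined})"
      by (auto simp: PiE_iff extensional_def split: if_splits)
    also have "compactin (product_topology (\<lambda>_. euclidean) UNIV) \<dots>"
      unfolding compactin_PiE using that by (auto simp: compactin_euclidean_iff)
    finally show ?thesis by (simp add: euclidean_product_topology compactin_euclidean_iff)
  qed
  show "compact (({1..d::nat} \<rightarrow>\<^sub>E {0..1}) :: (nat \<Rightarrow> real) set)" by (rule *) simp
  show "compact (({1..d::nat} \<rightarrow>\<^sub>E sphere 0 1) :: (nat \<Rightarrow> complex) set)" by (rule *) simp
qed

definition torus_map :: "nat \<Rightarrow> (nat \<Rightarrow> real) \<Rightarrow> (nat \<Rightarrow> complex)" where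
  "torus_map d x = (\<lambda>j\<in>{1..d}. cis (2 * pi * x j))"

lemma torus_map_image: "torus_map d ` ({1..d} \<rightarrow>\<^sub>E {0..1}) = {1..d} \<rightarrow>\<^sub>E sphere 0 1"
proof (intro equalityI subsetI)
  fix w :: "nat \<Rightarrow> complex" assume w: "w \<in> {1..d} \<rightarrow>\<^sub>E sphere 0 1"
  let ?x = "\<lambda>j\<in>{1..d}. Arg2pi (w j) / (2 * pi)"
  have "cis (Arg2pi (w j)) = w j" if "j \<in> {1..d}" for j
    using Arg2pi_eq[of "w j"] w that by (auto simp: PiE_iff cis_conv_exp)
  then have "torus_map d ?x = w"
    using w by (auto simp: torus_map_def fun_eq_iff PiE_iff extensional_def)
  moreover have "?x \<in> {1..d} \<rightarrow>\<^sub>E {0..1}"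
    using Arg2pi_ge_0 Arg2pi_lt_2pi by (auto simp: less_imp_le)
  ultimately show "w \<in> torus_map d ` ({1..d} \<rightarrow>\<^sub>E {0..1})" by (metis image_eqI)
qed (auto simp: torus_map_def)

lemma continuous_on_torus_map: "continuous_on S (torus_map d)"
proof (rule continuous_on_coordinatewise_then_product)
  fix j
  have "continuous_on S (\<lambda>x. cis (2 * pi * x j))"
    by (intro continuous_on_cis_real continuous_on_mult continuous_on_const continuous_on_coordinate)
  then show "continuous_on S (\<lambda>x. torus_map d x j)"
    by (cases "j \<in> {1..d}") (auto simp: torus_map_def)
qed

text \<open>On the cube, \<open>torus_map\<close> is a closed surjection onto the torus, so that a continuous periodic
  function descends to a continuous function.\<close>

lemma periodic_factors_torus:
  assumes f: "continuous_on (real_vecs d) f" "one_periodic d f"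
  obtains F where "continuous_on ({1..d} \<rightarrow>\<^sub>E sphere 0 1) F"
    "\<And>x. x \<in> {1..d} \<rightarrow>\<^sub>E {0..1} \<Longrightarrow> F (torus_map d x) = f x"
proof
  let ?K = "({1..d} \<rightarrow>\<^sub>E {0..1}) :: (nat \<Rightarrow> real) set"
  let ?S = "({1..d} \<rightarrow>\<^sub>E sphere 0 1) :: (nat \<Rightarrow> complex) set"
  define F where "F w = f (\<lambda>j\<in>{1..d}. Arg2pi (w j) / (2 * pi))" for w
  show *: "F (torus_map d x) = f x" if x: "x \<in> ?K" for x
  proof -
    define y where "y = (\<lambda>j\<in>{1..d}. Arg2pi (torus_map d x j) / (2 * pi))"
    \<comment> \<open>\<open>Arg2pi\<close> sends the image of coordinate 1 to 0, so
      \<open>y\<close> is \<open>x\<close> with its coordinates 1 replaced by 0, and a unit shift on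
      exactly this set recovers \<open>x\<close>.\<close>
    define A where "A = {j\<in>{1..d}. x j = 1}"
    have y: "y j = (if j \<in> A then 0 else x j)" if j: "j \<in> {1..d}" for j
    proof -
      have "Arg2pi (cis (2 * pi * t)) = 2 * pi * t" if "0 \<le> t" "t < 1" for t
        using that by (intro Arg2pi_unique[of 1]) (auto simp: cis_conv_exp)
      from this[of 0] this[of "x j"] show ?thesis
        using x j by (auto simp: y_def A_def torus_map_def PiE_iff dest!: bspec[of _ _ j])
    qed
    have "y \<in> real_vecs d" by (auto simp: y_def real_vecs_def)
    then have "f (\<lambda>j\<in>{1..d}. if j \<in> A then y j + 1 else y j) = f y"
      using f(2) by (intro one_periodic_restrict_add) (auto simp: A_def)
    also have "(\<lambda>j\<in>{1..d}. if j \<in> A then y j + 1 else y j) = x"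
      using x y by (auto simp: A_def fun_eq_iff PiE_iff extensional_def)
    finally show ?thesis unfolding F_def y_def[symmetric] by (rule sym)
  qed
  have "closed ?S" by (rule compact_imp_closed) (rule compact_torus)
  then show "continuous_on ?S F"
  proof (subst continuous_on_closed_vimage, simp, intro allI impI)
    fix B :: "complex set" assume "closed B"
    have "continuous_on ?K f" using f(1) cube_subset_real_vecs by (rule continuous_on_subset)
    then have "closed (f -` B \<inter> ?K)"
      using \<open>closed B\<close> compact_imp_closed[OF compact_cube] by (simp add: continuous_on_closed_vimage)
    then have "compact (?K \<inter> (f -` B \<inter> ?K))" by (rule compact_Int_closed[OF compact_cube])
    then have "compact (torus_map d ` (?K \<inter> (f -` B \<inter> ?K)))"
      by (rule compact_continuous_image[OF continuous_on_torus_map])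
    also have "torus_map d ` (?K \<inter> (f -` B \<inter> ?K)) = F -` B \<inter> ?S"
      unfolding torus_map_image[symmetric] using * by auto
    finally show "closed (F -` B \<inter> ?S)" by (rule compact_imp_closed)
  qed
qed

text \<open>Real-valued because Stone-Weierstrass is applied to a ring of real functions. Membership
  is tested after pulling back to the cube, so that an approximant is a trigonometric polynomial by
  definition.\<close>

definition torus_ring :: "nat \<Rightarrow> ((nat \<Rightarrow> complex) \<Rightarrow> real) set" where
  "torus_ring d = {u. continuous_on ({1..d} \<rightarrow>\<^sub>E sphere 0 1) u \<and>
     (\<lambda>x. complex_of_real (u (torus_map d x))) \<in> trig_polys d}"

text \<open>These functions separate the points of the torus. They are combinations of the character
  whose frequency is the unit vector in direction \<open>j\<close> and of its conjugate.\<close>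

lemma torus_ring_coordinates:
  assumes "j \<in> {1..d}"
  shows "(\<lambda>w. Re (w j)) \<in> torus_ring d" "(\<lambda>w. Im (w j)) \<in> torus_ring d"
proof -
  define h :: "nat \<Rightarrow> int" where "h = (\<lambda>i. if i = j then 1 else 0)"
  have "fchar d h x = cis (2 * pi * x j)" for x
  proof -
    have "(\<Sum>i\<in>{1..d}. real_of_int (h i) * x i) = (\<Sum>i\<in>{1..d}. if i = j then x j else 0)"
      by (intro sum.cong) (auto simp: h_def)
    then show ?thesis using assms by (simp add: fchar_def)
  qed
  moreover have "fchar d (\<lambda>i. - h i) x = cnj (fchar d h x)" for x
    by (rule cnj_fchar[symmetric])
  ultimately have 1: "complex_of_real (Re (torus_map d x j)) = 1/2 * fchar d h x + 1/2 * fchar d (\<lambda>i. - h i) x"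
    and 2: "complex_of_real (Im (torus_map d x j)) = (-\<i>/2) * fchar d h x + (\<i>/2) * fchar d (\<lambda>i. - h i) x" for x
    using assms by (simp_all add: torus_map_def complex_eq_iff)
  have cont: "continuous_on S (\<lambda>w::nat \<Rightarrow> complex. w j)" for S
    by (rule continuous_on_coordinate)
  show "(\<lambda>w. Re (w j)) \<in> torus_ring d"
    unfolding torus_ring_def mem_Collect_eq 1
    by (intro conjI continuous_on_Re cont trig_polys.intros)
  show "(\<lambda>w. Im (w j)) \<in> torus_ring d"
    unfolding torus_ring_def mem_Collect_eq 2
    by (intro conjI continuous_on_Im cont trig_polys.intros)
qed

lemma function_ring_torus: "function_ring_on (torus_ring d) ({1..d} \<rightarrow>\<^sub>E sphere 0 1)"
proof
  show "compact (({1..d} \<rightarrow>\<^sub>E sphere 0 1) :: (nat \<Rightarrow> complex) set)" by (rule compact_torus)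
next
  fix v w :: "nat \<Rightarrow> complex"
  assume "v \<in> {1..d} \<rightarrow>\<^sub>E sphere 0 1" "w \<in> {1..d} \<rightarrow>\<^sub>E sphere 0 1" "v \<noteq> w"
  then obtain j where "j \<in> {1..d}" "v j \<noteq> w j" by (metis PiE_ext)
  then show "\<exists>u\<in>torus_ring d. u v \<noteq> u w"
    using torus_ring_coordinates[of j d] by (metis complex_eqI)
next
  show "continuous_on ({1..d} \<rightarrow>\<^sub>E sphere 0 1) u" if "u \<in> torus_ring d" for u
    using that by (simp add: torus_ring_def)
next
  fix u v assume "u \<in> torus_ring d" "v \<in> torus_ring d"
  then show "(\<lambda>x. u x + v x) \<in> torus_ring d" "(\<lambda>x. u x * v x) \<in> torus_ring d"
    by (auto simp: torus_ring_def intro: continuous_on_add continuous_on_mult trig_polys.intros(3) trig_polys_mult)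
next
  show "(\<lambda>_. c) \<in> torus_ring d" for c
    by (simp add: torus_ring_def trig_polys_const)
qed

text \<open>Stone-Weierstrass on the torus for the real and the imaginary part of the factored
  function, each within half of the tolerance, then pulled back to the cube.\<close>

lemma trig_polys_dense:
  assumes "continuous_on (real_vecs d) f" "one_periodic d f" "\<epsilon> > 0"
  shows "\<exists>T\<in>trig_polys d. \<forall>x\<in>{1..d} \<rightarrow>\<^sub>E {0..1}. cmod (f x - T x) < \<epsilon>"
proof -
  obtain F where F: "continuous_on ({1..d} \<rightarrow>\<^sub>E sphere 0 1) F"
    and Ff: "\<And>x. x \<in> {1..d} \<rightarrow>\<^sub>E {0..1} \<Longrightarrow> F (torus_map d x) = f x"
    using periodic_factors_torus[OF assms(1,2)] by blast
  interpret function_ring_on "torus_ring d" "{1..d} \<rightarrow>\<^sub>E sphere 0 1"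
    by (rule function_ring_torus)
  have "continuous_on ({1..d} \<rightarrow>\<^sub>E sphere 0 1) (\<lambda>w. Re (F w))"
    "continuous_on ({1..d} \<rightarrow>\<^sub>E sphere 0 1) (\<lambda>w. Im (F w))"
    using F by (auto intro: continuous_intros)
  from this[THEN Stone_Weierstrass_basic, of "\<epsilon> / 2"] assms(3)
  obtain u v where u: "u \<in> torus_ring d" "\<And>w. w \<in> {1..d} \<rightarrow>\<^sub>E sphere 0 1 \<Longrightarrow> \<bar>Re (F w) - u w\<bar> < \<epsilon> / 2"
    and v: "v \<in> torus_ring d" "\<And>w. w \<in> {1..d} \<rightarrow>\<^sub>E sphere 0 1 \<Longrightarrow> \<bar>Im (F w) - v w\<bar> < \<epsilon> / 2"
    by (metis half_gt_zero)
  show ?thesis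
  proof (intro bexI ballI)
    show "(\<lambda>x. complex_of_real (u (torus_map d x)) + \<i> * complex_of_real (v (torus_map d x))) \<in> trig_polys d"
      using u(1) v(1) by (auto simp: torus_ring_def intro: trig_polys.intros)
  next
    fix x :: "nat \<Rightarrow> real" assume x: "x \<in> {1..d} \<rightarrow>\<^sub>E {0..1}"
    then have w: "torus_map d x \<in> {1..d} \<rightarrow>\<^sub>E sphere 0 1" using torus_map_image by blast
    let ?z = "f x - (complex_of_real (u (torus_map d x)) + \<i> * complex_of_real (v (torus_map d x)))"
    have "cmod ?z \<le> \<bar>Re ?z\<bar> + \<bar>Im ?z\<bar>" by (rule cmod_le)
    also have "\<dots> < \<epsilon> / 2 + \<epsilon> / 2"
      using u(2)[OF w] v(2)[OF w] by (simp add: Ff[OF x])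
    finally show "cmod ?z < \<epsilon>" by simp
  qed
qed

section \<open>Uniqueness of Fourier coefficients and pointwise Fourier series\<close>

lemma borel_measurable_cnj [measurable]:
  "f \<in> borel_measurable M \<Longrightarrow> (\<lambda>x. cnj (f x)) \<in> borel_measurable M"
  by (rule measurable_compose[OF _ borel_measurable_continuous_onI]) (auto intro: continuous_intros)

text \<open>Continuity refers to the topology of functions on all naturals, measurability to the
  product sigma-algebra of \<open>cube d\<close>. Trigonometric polynomials are measurable
  coordinate by coordinate and approximate \<open>f\<close> uniformly, which bridges the
  two.\<close>

lemma measurable_continuous_periodic:
  assumes "continuous_on (real_vecs d) f" "one_periodic d f"
  shows "f \<in> borel_measurable (cube d)"
proof -
  have "\<exists>T\<in>trig_polys d. \<forall>x\<in>{1..d} \<rightarrow>\<^sub>E {0..1}. cmod (f x - T x) < 1 / real (Suc n)" for n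
    by (intro trig_polys_dense assms) simp
  then obtain T where T: "\<And>n. T n \<in> trig_polys d"
    "\<And>n x. x \<in> {1..d} \<rightarrow>\<^sub>E {0..1} \<Longrightarrow> cmod (f x - T n x) < 1 / real (Suc n)"
    by metis
  show ?thesis
  proof (rule borel_measurable_LIMSEQ_metric)
    show "T n \<in> borel_measurable (cube d)" for n using T(1) by (rule measurable_trig_polys)
    fix x assume "x \<in> space (cube d)"
    then have "norm (T n x - f x) \<le> 1 / real (Suc n)" for n
      using T(2)[of x n] by (simp add: space_cube norm_minus_commute less_imp_le)
    then have "(\<lambda>n. T n x - f x) \<longlonglongrightarrow> 0"
      by (intro Lim_null_comparison[OF always_eventually LIMSEQ_Suc[OF lim_1_over_n]] allI)
    then show "(\<lambda>n. T n x) \<longlonglongrightarrow> f x" by (rule LIM_zero_cancel)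
  qed
qed

lemma continuous_bounded_cube:
  fixes f :: integrand
  assumes "continuous_on (real_vecs d) f"
  shows "\<exists>B\<ge>0. \<forall>x\<in>{1..d} \<rightarrow>\<^sub>E {0..1}. cmod (f x) \<le> B"
proof -
  have "compact (f ` ({1..d} \<rightarrow>\<^sub>E {0..1}))"
    using continuous_on_subset[OF assms cube_subset_real_vecs] by (rule compact_continuous_image) (rule compact_cube)
  then have "bounded (f ` ({1..d} \<rightarrow>\<^sub>E {0..1}))" by (rule compact_imp_bounded)
  then obtain B where "\<And>x. x \<in> {1..d} \<rightarrow>\<^sub>E {0..1} \<Longrightarrow> cmod (f x) \<le> B"
    by (auto simp: bounded_iff)
  then show ?thesis by (intro exI[of _ "max B 0"]) (auto simp: le_max_iff_disj)
qed

lemma emeasure_unit_interval_open_pos: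
  assumes "open X" "t \<in> X" "t \<in> {0..1}"
  shows "emeasure unit_interval (X \<inter> {0..1}) > 0"
proof -
  obtain e where e: "e > 0" "ball t e \<subseteq> X" using assms(1,2) open_contains_ball by blast
  define a b where "a = max 0 (t - e / 2)" and "b = min 1 (t + e / 2)"
  have "a < b" using e assms(3) by (auto simp: a_def b_def)
  have "{a..b} \<subseteq> X \<inter> {0..1}"
    using e assms(3) by (intro subset_trans[OF _ Int_mono[OF e(2) subset_refl]]) (auto simp: a_def b_def dist_real_def abs_if)
  then have "emeasure lborel {a..b} \<le> emeasure lborel (X \<inter> {0..1})"
    using assms(1) by (intro emeasure_mono) auto
  moreover have "emeasure lborel {a..b} > 0" using \<open>a < b\<close> by simp
  moreover have "emeasure unit_interval (X \<inter> {0..1}) = emeasure lborel (X \<inter> {0..1})"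
    by (rule emeasure_restrict_space) auto
  ultimately show ?thesis by simp
qed

text \<open>Around a point with nonzero value there is an open box on which \<open>g\<close> does
  not vanish, and its measure is a product of positive lengths. Coordinates outside
  \<open>{1..d}\<close> are fixed to \<open>undefined\<close>, so the box may be cut down to the
  first \<open>d\<close> coordinates.\<close>

lemma AE_cube_continuous_eq_0:
  assumes g: "continuous_on ({1..d} \<rightarrow>\<^sub>E {0..1}) (g :: integrand)" and AE: "AE x in cube d. g x = 0"
    and x: "x \<in> {1..d} \<rightarrow>\<^sub>E {0..1}"
  shows "g x = 0"
proof (rule ccontr)
  let ?K = "({1..d} \<rightarrow>\<^sub>E {0..1}) :: (nat \<Rightarrow> real) set"
  assume "g x \<noteq> 0"
  have "open (- {0::complex})" by auto
  from continuous_on_open_invariant[THEN iffD1, rule_format, OF g this]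
  obtain U where U: "open U" "U \<inter> ?K = g -` (- {0}) \<inter> ?K"
    by (elim exE conjE)
  have "openin (product_topology (\<lambda>_. euclidean) UNIV) U"
    using U(1) by (simp add: euclidean_product_topology)
  moreover have "x \<in> U" using U(2) x \<open>g x \<noteq> 0\<close> by auto
  ultimately have "\<exists>X. x \<in> (\<Pi>\<^sub>E i\<in>UNIV. X i) \<and> (\<forall>i. openin euclidean (X i)) \<and>
      finite {i. X i \<noteq> topspace euclidean} \<and> (\<Pi>\<^sub>E i\<in>UNIV. X i) \<subseteq> U"
    by (rule product_topology_open_contains_basis)
  then obtain X where X: "x \<in> (\<Pi>\<^sub>E i\<in>UNIV. X i)" "\<And>i. open (X i)" "(\<Pi>\<^sub>E i\<in>UNIV. X i) \<subseteq> U"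
    by (metis open_openin)
  define Y where "Y = (\<Pi>\<^sub>E j\<in>{1..d}. X j \<inter> {0..1})"
  have "Y \<subseteq> U \<inter> ?K"
  proof
    fix y assume y: "y \<in> Y"
    have "y i \<in> X i" for i
    proof (cases "i \<in> {1..d}")
      case False
      then have "y i = x i" using x y by (auto simp: Y_def PiE_iff extensional_def)
      then show ?thesis using X(1) by auto
    qed (use y in \<open>auto simp: Y_def PiE_iff\<close>)
    then have "y \<in> U" using X(3) by auto
    moreover have "y \<in> ?K" using y by (auto simp: Y_def PiE_iff)
    ultimately show "y \<in> U \<inter> ?K" by blast
  qed
  have "emeasure (cube d) Y = (\<Prod>j\<in>{1..d}. emeasure unit_interval (X j \<inter> {0..1}))"
    unfolding cube_def Y_def
    by (rule product_sigma_finite.emeasure_PiM[OF product_sigma_finite_unit_interval])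
      (use X(2) in \<open>auto simp: sets_restrict_space\<close>)
  moreover have "emeasure unit_interval (X j \<inter> {0..1}) \<noteq> 0" if "j \<in> {1..d}" for j
    using emeasure_unit_interval_open_pos[OF X(2), of "x j" j] X(1) x that by (force simp: PiE_iff)
  ultimately have "emeasure (cube d) Y \<noteq> 0" by simp
  moreover have "y \<notin> Y" if "g y = 0" for y
    using that \<open>Y \<subseteq> U \<inter> ?K\<close> unfolding U(2) by auto
  with AE have "AE y in cube d. \<not> y \<in> Y"
    by (auto elim: eventually_mono)
  then have "emeasure (cube d) {y\<in>space (cube d). y \<in> Y} = 0" by (rule emeasure_eq_0_AE)
  moreover have "{y\<in>space (cube d). y \<in> Y} = Y" using \<open>Y \<subseteq> U \<inter> ?K\<close> by (auto simp: space_cube)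
  ultimately show False by simp
qed

text \<open>By linearity \<open>g\<close> is orthogonal to every trigonometric polynomial.
  Approximating \<open>cnj (g x)\<close> uniformly by such polynomials shows that the integral of
  the squared modulus is 0, and continuity upgrades almost everywhere to everywhere.\<close>

lemma fourier_coeff_unique:
  assumes g: "continuous_on (real_vecs d) g" "one_periodic d g"
    and 0: "\<And>h. h \<in> int_vecs d \<Longrightarrow> fourier_coeff d g h = 0"
    and x: "x \<in> {1..d} \<rightarrow>\<^sub>E {0..1}"
  shows "g x = 0"
proof -
  have meas: "g \<in> borel_measurable (cube d)" by (rule measurable_continuous_periodic[OF g])
  obtain B where B: "B \<ge> 0" "\<And>x. x \<in> {1..d} \<rightarrow>\<^sub>E {0..1} \<Longrightarrow> cmod (g x) \<le> B"
    using continuous_bounded_cube[OF g(1)] by blast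
  have int: "integrable (cube d) (\<lambda>x. g x * T x)" if T: "T \<in> trig_polys d" for T
  proof -
    obtain C where "\<And>x. cmod (T x) \<le> C" using trig_polys_bounded[OF T] by blast
    then show ?thesis
      using B meas measurable_trig_polys[OF T]
      by (intro integrable_cube_bounded[of _ _ "B * C"]) (auto simp: norm_mult intro!: mult_mono)
  qed
  have orth: "(LINT x|cube d. g x * T x) = 0" if "T \<in> trig_polys d" for T
    using that
  proof induction
    case (1 h)
    let ?k = "\<lambda>j\<in>{1..d}. - h j"
    have "fchar d h x = cnj (fchar d ?k x)" for x
      unfolding cnj_fchar by (rule fchar_cong) simp
    then show ?case using 0[of ?k] by (simp add: fourier_coeff_fchar int_vecs_def)
  next
    case (2 T c)
    have "(LINT x|cube d. g x * (c * T x)) = (LINT x|cube d. c * (g x * T x))" by (simp add: mult_ac)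
    then show ?case using 2 by simp
  next
    case (3 T U)
    then show ?case using int by (simp add: distrib_left)
  qed
  have small: "cmod (LINT x|cube d. g x * cnj (g x)) \<le> B * \<epsilon>" if eps: "\<epsilon> > 0" for \<epsilon>
  proof -
    have "continuous_on (real_vecs d) (\<lambda>x. cnj (g x))" using g(1) by (intro continuous_intros)
    moreover have "one_periodic d (\<lambda>x. cnj (g x))" using g(2) by (simp add: one_periodic_def)
    ultimately obtain T where T: "T \<in> trig_polys d"
      "\<And>x. x \<in> {1..d} \<rightarrow>\<^sub>E {0..1} \<Longrightarrow> cmod (cnj (g x) - T x) < \<epsilon>"
      using trig_polys_dense[of d "\<lambda>x. cnj (g x)" \<epsilon>] eps by blast
    have i: "integrable (cube d) (\<lambda>x. g x * cnj (g x))"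
      using B meas by (intro integrable_cube_bounded[of _ _ "B * B"]) (auto simp: norm_mult intro!: mult_mono)
    have "(LINT x|cube d. g x * (cnj (g x) - T x)) = (LINT x|cube d. g x * cnj (g x))"
      using i int[OF T(1)] orth[OF T(1)] by (simp add: right_diff_distrib)
    moreover have "cmod (LINT x|cube d. g x * (cnj (g x) - T x)) \<le> B * \<epsilon>"
      using B meas measurable_trig_polys[OF T(1)] T(2)
      by (intro norm_integral_cube_le) (auto simp: norm_mult less_imp_le intro!: mult_mono)
    ultimately show ?thesis by simp
  qed
  have "cmod (LINT x|cube d. g x * cnj (g x)) \<le> 0 + \<epsilon>" if "\<epsilon> > 0" for \<epsilon>
  proof -
    \<comment> \<open>Dividing by \<open>B + 1\<close> instead of \<open>B\<close> covers the case
      \<open>B = 0\<close>.\<close>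
    have "B * (\<epsilon> / (B + 1)) \<le> \<epsilon>" using that B(1) by (simp add: field_simps)
    with small[of "\<epsilon> / (B + 1)"] that B(1) show ?thesis by simp
  qed
  then have "(LINT x|cube d. g x * cnj (g x)) = 0"
    using field_le_epsilon[of "cmod (LINT x|cube d. g x * cnj (g x))" 0] by simp
  moreover have "(LINT x|cube d. g x * cnj (g x)) = (LINT x|cube d. complex_of_real ((cmod (g x))\<^sup>2))"
    by (simp only: complex_norm_square)
  ultimately have "(LINT x|cube d. (cmod (g x))\<^sup>2) = 0"
    by (simp only: integral_complex_of_real of_real_eq_0_iff)
  moreover have "integrable (cube d) (\<lambda>x. (cmod (g x))\<^sup>2)"
    using B meas by (intro integrable_cube_bounded[of _ _ "B\<^sup>2"]) (auto intro!: power_mono)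
  ultimately have "AE x in cube d. g x = 0"
    by (subst (asm) integral_nonneg_eq_0_iff_AE) auto
  then show ?thesis
    using continuous_on_subset[OF g(1) cube_subset_real_vecs] x by (intro AE_cube_continuous_eq_0)
qed

lemma int_vecs_eqI:
  assumes "h \<in> int_vecs d" "k \<in> int_vecs d" "\<And>j. j \<in> {1..d} \<Longrightarrow> h j = k j"
  shows "h = k"
  using assms unfolding int_vecs_def by (rule PiE_ext)

lemma integral_fchar_cnj:
  assumes "h \<in> int_vecs d" "k \<in> int_vecs d"
  shows "(LINT x|cube d. fchar d h x * cnj (fchar d k x)) = of_bool (h = k)"
proof -
  have "(\<forall>j\<in>{1..d}. h j - k j = 0) \<longleftrightarrow> h = k"
    using int_vecs_eqI[OF assms] by auto
  then show ?thesis by (simp add: cnj_fchar fchar_mult integral_fchar)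
qed

text \<open>Summable coefficients make the series converge uniformly to a continuous periodic
  \<open>S\<close>. It has the coefficients of \<open>f\<close>, so \<open>f - S\<close> vanishes by
  \<open>fourier_coeff_unique\<close>.\<close>

lemma fourier_series_has_sum:
  assumes f: "continuous_on (real_vecs d) f" "one_periodic d f"
    and sum: "(\<lambda>h. cmod (fourier_coeff d f h)) summable_on int_vecs d"
    and x: "x \<in> {1..d} \<rightarrow>\<^sub>E {0..1}"
  shows "((\<lambda>h. fourier_coeff d f h * fchar d h x) has_sum f x) (int_vecs d)"
proof -
  define c where "c = fourier_coeff d f"
  define S where "S x = (\<Sum>\<^sub>\<infinity>h\<in>int_vecs d. c h * fchar d h x)" for x
  have ul: "uniform_limit UNIV (\<lambda>H x. \<Sum>h\<in>H. c h * fchar d h x) S (finite_subsets_at_top (int_vecs d))"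
    unfolding S_def using sum
    by (intro Weierstrass_m_test_general[of _ _ _ "\<lambda>h. cmod (c h)"]) (auto simp: norm_mult c_def)
  have S1: "continuous_on (real_vecs d) S"
  proof (rule uniform_limit_theorem)
    show "uniform_limit (real_vecs d) (\<lambda>H x. \<Sum>h\<in>H. c h * fchar d h x) S (finite_subsets_at_top (int_vecs d))"
      using ul by (rule uniform_limit_on_subset) simp
    show "\<forall>\<^sub>F H in finite_subsets_at_top (int_vecs d). continuous_on (real_vecs d) (\<lambda>x. \<Sum>h\<in>H. c h * fchar d h x)"
      by (intro always_eventually allI continuous_on_sum continuous_on_mult continuous_on_const continuous_on_fchar)
  qed simp
  have S2: "one_periodic d S"
    using one_periodic_fchar unfolding one_periodic_def S_def by (auto intro!: infsum_cong)
  have meas: "f \<in> borel_measurable (cube d)" "S \<in> borel_measurable (cube d)"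
    using f S1 S2 by (auto intro: measurable_continuous_periodic)
  have int: "integrable (cube d) (\<lambda>x. g x * cnj (fchar d k x))"
    if g: "g \<in> borel_measurable (cube d)" "continuous_on (real_vecs d) g" for g k
  proof -
    obtain B where "B \<ge> 0" "\<And>x. x \<in> {1..d} \<rightarrow>\<^sub>E {0..1} \<Longrightarrow> cmod (g x) \<le> B"
      using continuous_bounded_cube[OF g(2)] by blast
    then show ?thesis using g(1) by (intro integrable_cube_bounded[of _ _ B]) (auto simp: norm_mult cnj_fchar)
  qed
  have coeff: "fourier_coeff d S k = c k" if k: "k \<in> int_vecs d" for k
  proof -
    \<comment> \<open>A finite partial sum that contains the frequency \<open>k\<close> has
      \<open>k\<close>-th coefficient exactly \<open>c k\<close>, and uniform closeness to
      \<open>S\<close> carries over to the coefficients.\<close>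
    have "cmod (fourier_coeff d S k - c k) \<le> 0 + \<epsilon>" if eps: "\<epsilon> > 0" for \<epsilon>
    proof -
      have "\<forall>\<^sub>F H in finite_subsets_at_top (int_vecs d). (\<forall>x\<in>UNIV. dist (\<Sum>h\<in>H. c h * fchar d h x) (S x) < \<epsilon>)
          \<and> finite H \<and> {k} \<subseteq> H \<and> H \<subseteq> int_vecs d"
        using uniform_limitD[OF ul eps] k
        by (intro eventually_conj) (auto simp: eventually_finite_subsets_at_top)
      then obtain H where H: "\<And>x. cmod (S x - (\<Sum>h\<in>H. c h * fchar d h x)) < \<epsilon>"
        "finite H" "k \<in> H" "H \<subseteq> int_vecs d"
        by (auto dest!: eventually_happens simp: dist_norm norm_minus_commute)
      define P where "P x = (\<Sum>h\<in>H. c h * fchar d h x)" for x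
      have P: "P \<in> borel_measurable (cube d)" "continuous_on (real_vecs d) P"
        unfolding P_def[abs_def]
        by (auto intro!: borel_measurable_sum continuous_on_sum continuous_on_mult continuous_on_const continuous_on_fchar)
      have "(LINT x|cube d. P x * cnj (fchar d k x))
          = (LINT x|cube d. (\<Sum>h\<in>H. c h * (fchar d h x * cnj (fchar d k x))))"
        by (simp add: P_def sum_distrib_right mult.assoc)
      also have "\<dots> = (\<Sum>h\<in>H. c h * (LINT x|cube d. fchar d h x * cnj (fchar d k x)))"
        using int[OF measurable_fchar continuous_on_fchar] by (subst Bochner_Integration.integral_sum) auto
      also have "\<dots> = (\<Sum>h\<in>H. if h = k then c k else 0)"
        using H(4) k by (intro sum.cong) (auto simp: integral_fchar_cnj)
      also have "\<dots> = c k" using H(2,3) by simp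
      finally have "fourier_coeff d S k - c k = (LINT x|cube d. (S x - P x) * cnj (fchar d k x))"
        using int[OF meas(2) S1] int[OF P] by (simp add: fourier_coeff_fchar left_diff_distrib)
      also have "cmod \<dots> \<le> \<epsilon>"
        using meas(2) P(1) H(1)[folded P_def]
        by (intro norm_integral_cube_le) (auto simp: norm_mult cnj_fchar intro: less_imp_le)
      finally show ?thesis by simp
    qed
    then have "cmod (fourier_coeff d S k - c k) \<le> 0" by (rule field_le_epsilon)
    then show ?thesis by simp
  qed
  have "f x - S x = 0"
  proof (rule fourier_coeff_unique[OF _ _ _ x])
    show "continuous_on (real_vecs d) (\<lambda>x. f x - S x)" using f(1) S1 by (rule continuous_on_diff)
    show "one_periodic d (\<lambda>x. f x - S x)" using f(2) S2 by (simp add: one_periodic_def)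
    show "fourier_coeff d (\<lambda>x. f x - S x) h = 0" if "h \<in> int_vecs d" for h
      using coeff[OF that] int[OF meas(1) f(1)] int[OF meas(2) S1]
      by (simp add: fourier_coeff_fchar left_diff_distrib c_def)
  qed
  moreover have "(\<lambda>h. c h * fchar d h x) summable_on int_vecs d"
    by (rule abs_summable_summable) (use sum in \<open>simp add: norm_mult c_def\<close>)
  then have "((\<lambda>h. c h * fchar d h x) has_sum S x) (int_vecs d)"
    unfolding S_def by (rule has_sum_infsum)
  ultimately show ?thesis by (simp add: c_def)
qed


section \<open>The error of a lattice rule as a sum over its dual lattice\<close>

lemma sum_cis_roots:
  assumes "m > 0"
  shows "(\<Sum>k<m. cis (2 * pi * (real k * real_of_int a / real m))) = (if int m dvd a then of_nat m else 0)"
proof -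
  define w where "w = cis (2 * pi * (real_of_int a / real m))"
  have pow: "w ^ k = cis (2 * pi * (real k * real_of_int a / real m))" for k
    unfolding w_def Complex.DeMoivre by (simp add: mult_ac)
  have "w = 1 \<longleftrightarrow> int m dvd a"
  proof
    assume "int m dvd a"
    then obtain c where "a = int m * c" by (elim dvdE)
    then have "real_of_int a / real m = real_of_int c" using assms by simp
    then show "w = 1" using cis_2pi_add_int[of 0 c] by (simp add: w_def)
  next
    assume "w = 1"
    then have "cos (2 * pi * (real_of_int a / real m)) = 1"
      unfolding w_def by (metis cis.simps(1) one_complex.simps(1))
    then obtain c :: int where "2 * pi * (real_of_int a / real m) = real_of_int c * 2 * pi"
      by (auto simp: cos_one_2pi_int)
    then have "real_of_int a = real_of_int (c * int m)" using assms by (simp add: field_simps)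
    then show "int m dvd a" by (metis dvd_triv_right of_int_eq_iff)
  qed
  moreover have "w ^ m = 1"
    using cis_2pi_add_int[of 0 a] assms unfolding pow by simp
  then have "(\<Sum>k<m. w ^ k) = 0" if "w \<noteq> 1"
    using that by (simp add: geometric_sum)
  ultimately show ?thesis unfolding pow[symmetric] by auto
qed

definition dotp :: "nat \<Rightarrow> (nat \<Rightarrow> int) \<Rightarrow> (nat \<Rightarrow> int) \<Rightarrow> int" where
  "dotp d h z = (\<Sum>j\<in>{1..d}. h j * z j)"

text \<open>Reduction modulo \<open>m\<close> moves each coordinate of the point by an integer,
  which a character does not notice.\<close>

lemma fchar_lattice_point:
  assumes "m > 0"
  shows "fchar d h (\<lambda>j\<in>{1..d}. real_of_int ((int k * z j) mod int m) / real m)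
    = cis (2 * pi * (real k * real_of_int (dotp d h z) / real m))"
proof -
  have "real_of_int ((int k * z j) mod int m) / real m
      = real k * real_of_int (z j) / real m - real_of_int ((int k * z j) div int m)" for j
  proof -
    have "real_of_int ((int k * z j) mod int m) = real k * real_of_int (z j) - real m * real_of_int ((int k * z j) div int m)"
      by (simp flip: minus_div_mult_eq_mod)
    then show ?thesis using assms by (simp add: field_simps)
  qed
  then have "(\<Sum>j\<in>{1..d}. real_of_int (h j) * (\<lambda>j\<in>{1..d}. real_of_int ((int k * z j) mod int m) / real m) j)
      = (\<Sum>j\<in>{1..d}. real k / real m * real_of_int (h j * z j) - real_of_int (h j * ((int k * z j) div int m)))"
    by (intro sum.cong) (simp_all only: restrict_apply if_True, simp_all add: right_diff_distrib mult_ac)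
  also have "\<dots> = real k * real_of_int (dotp d h z) / real m + real_of_int (- (\<Sum>j\<in>{1..d}. h j * ((int k * z j) div int m)))"
    by (simp add: dotp_def sum_subtractf sum_distrib_left sum_divide_distrib)
  finally show ?thesis unfolding fchar_def by (simp only: cis_2pi_add_int)
qed

lemma has_sum_sum:
  fixes f :: "'b \<Rightarrow> 'a \<Rightarrow> 'c::topological_comm_monoid_add"
  assumes "\<And>i. i \<in> I \<Longrightarrow> (f i has_sum s i) A"
  shows "((\<lambda>x. \<Sum>i\<in>I. f i x) has_sum (\<Sum>i\<in>I. s i)) A"
  using assms by (induction I rule: infinite_finite_induct) (auto intro: has_sum_add)

text \<open>The zero vector is left out because its Fourier coefficient is the integral itself; the
  remaining frequencies make up the error.\<close>

definition dual_lattice :: "nat \<Rightarrow> nat \<Rightarrow> (nat \<Rightarrow> int) \<Rightarrow> (nat \<Rightarrow> int) set" where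
  "dual_lattice d m z = {h \<in> int_vecs d - {zero_vec d}. int m dvd dotp d h z}"

text \<open>Aliasing: summing the Fourier series over the lattice points turns each character into a
  sum of roots of unity, which is \<open>m\<close> or 0 according to whether \<open>m\<close>
  divides \<open>dotp d h z\<close>.\<close>

lemma lattice_rule_error:
  assumes f: "continuous_on (real_vecs d) f" "one_periodic d f"
    and sum: "(\<lambda>h. cmod (fourier_coeff d f h)) summable_on int_vecs d"
    and "m > 0"
  shows "cmod (lattice_rule d m z f - integral_cube d f) \<le> (\<Sum>\<^sub>\<infinity>h\<in>dual_lattice d m z. cmod (fourier_coeff d f h))"
proof -
  define c where "c = fourier_coeff d f"
  define x where "x k = (\<lambda>j\<in>{1..d}. real_of_int ((int k * z j) mod int m) / real m)" for k
  have "0 \<le> real_of_int (a mod int m) / real m" "real_of_int (a mod int m) / real m \<le> 1" for a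
  proof -
    have "0 \<le> a mod int m" "a mod int m < int m" using \<open>m > 0\<close> by simp_all
    then show "0 \<le> real_of_int (a mod int m) / real m" "real_of_int (a mod int m) / real m \<le> 1"
      using \<open>m > 0\<close> of_int_less_iff[of "a mod int m" "int m", where 'a = real] by auto
  qed
  then have x: "x k \<in> {1..d} \<rightarrow>\<^sub>E {0..1}" for k
    unfolding x_def by simp
  have "((\<lambda>h. \<Sum>k<m. c h * fchar d h (x k)) has_sum (\<Sum>k<m. f (x k))) (int_vecs d)"
    by (intro has_sum_sum fourier_series_has_sum[OF f sum x, folded c_def])
  then have "((\<lambda>h. (\<Sum>k<m. c h * fchar d h (x k)) / of_nat m) has_sum lattice_rule d m z f) (int_vecs d)"
    unfolding lattice_rule_def x_def by (rule has_sum_divide_const)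
  moreover have "fchar d h (x k) = cis (2 * pi * (real k * real_of_int (dotp d h z) / real m))" for h k
    unfolding x_def by (rule fchar_lattice_point[OF \<open>m > 0\<close>])
  then have "(\<Sum>k<m. c h * fchar d h (x k)) / of_nat m = (if int m dvd dotp d h z then c h else 0)" for h
    using \<open>m > 0\<close> by (simp only: sum_distrib_left[symmetric] sum_cis_roots) simp
  ultimately have "((\<lambda>h. if int m dvd dotp d h z then c h else 0) has_sum lattice_rule d m z f) (int_vecs d)"
    by simp
  then have "((\<lambda>h. if int m dvd dotp d h z then c h else 0) has_sum (lattice_rule d m z f - c (zero_vec d)))
      (int_vecs d - {zero_vec d})"
    by (rule has_sum_Diff) (auto intro!: has_sum_finiteI simp: dotp_def zero_vec_def int_vecs_def)
  also have "?this \<longleftrightarrow> (c has_sum (lattice_rule d m z f - c (zero_vec d))) (dual_lattice d m z)"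
    by (intro has_sum_cong_neutral) (auto simp: dual_lattice_def)
  also have "c (zero_vec d) = integral_cube d f"
    by (simp add: c_def fourier_coeff_def integral_cube_def zero_vec_def)
  finally have "(c has_sum (lattice_rule d m z f - integral_cube d f)) (dual_lattice d m z)" .
  moreover have "((\<lambda>h. cmod (c h)) has_sum (\<Sum>\<^sub>\<infinity>h\<in>dual_lattice d m z. cmod (c h))) (dual_lattice d m z)"
    unfolding c_def
    by (rule has_sum_infsum, rule summable_on_subset[OF sum]) (auto simp: dual_lattice_def)
  ultimately show ?thesis unfolding c_def by (rule norm_has_sum_bound[rotated])
qed

section \<open>The sums over the frequencies\<close>

lemma korobov_r_pos:
  assumes "positive_weights \<gamma>"
  shows "korobov_r d \<alpha> \<gamma> h > 0"
proof -
  have "finite (supp d h)" "supp d h \<subseteq> {1..}" by (auto simp: supp_def)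
  then have "\<gamma> (supp d h) > 0" using assms by (simp add: positive_weights_def)
  moreover have "(\<Prod>j\<in>supp d h. \<bar>real_of_int (h j)\<bar> powr \<alpha>) > 0"
    by (intro prod_pos) (auto simp: supp_def)
  ultimately show ?thesis by (simp add: korobov_r_def)
qed

lemma korobov_r_powr:
  assumes "positive_weights \<gamma>"
  shows "korobov_r d \<alpha> \<gamma> h powr (- 1 / lam)
    = \<gamma> (supp d h) powr (1 / lam) * (\<Prod>j\<in>supp d h. \<bar>real_of_int (h j)\<bar> powr (- (\<alpha> / lam)))"
proof -
  have "finite (supp d h)" "supp d h \<subseteq> {1..}" by (auto simp: supp_def)
  then have pos: "\<gamma> (supp d h) > 0" using assms by (simp add: positive_weights_def)
  have "korobov_r d \<alpha> \<gamma> h powr (- 1 / lam)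
      = inverse (\<gamma> (supp d h)) powr (- 1 / lam) * (\<Prod>j\<in>supp d h. (\<bar>real_of_int (h j)\<bar> powr \<alpha>) powr (- 1 / lam))"
    unfolding korobov_r_def using pos
    by (subst powr_mult) (auto simp: prod_powr_distrib prod_nonneg)
  moreover have "inverse (\<gamma> (supp d h)) powr (- 1 / lam) = \<gamma> (supp d h) powr (1 / lam)"
    using pos by (simp add: powr_def ln_inverse)
  ultimately show ?thesis by (simp add: powr_powr)
qed

lemma has_sum_real_zeta:
  assumes "s > 1"
  shows "((\<lambda>k. 1 / real (Suc k) powr s) has_sum real_zeta s) UNIV"
proof (rule sums_nonneg_imp_has_sum)
  have "summable (\<lambda>k. real k powr - s)" using assms by (simp add: summable_real_powr_iff)
  then have "summable (\<lambda>k. real (Suc k) powr - s)" by (subst summable_Suc_iff)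
  then show "(\<lambda>k. 1 / real (Suc k) powr s) sums real_zeta s"
    unfolding real_zeta_def by (simp add: powr_minus_divide summable_sums)
qed simp

lemma has_sum_nonzero_int_powr:
  assumes "s > 1"
  shows "((\<lambda>k::int. \<bar>real_of_int k\<bar> powr - s) has_sum (2 * real_zeta s)) (UNIV - {0})"
proof -
  have pos: "((\<lambda>k::int. \<bar>real_of_int k\<bar> powr - s) has_sum real_zeta s) {0<..}"
    using has_sum_real_zeta[OF assms]
    by (subst has_sum_reindex_bij_witness[of _ "\<lambda>k. int (Suc k)" "\<lambda>k. nat (k - 1)" UNIV "\<lambda>k. 1 / real (Suc k) powr s"])
      (auto simp: powr_minus_divide)
  have neg: "((\<lambda>k::int. \<bar>real_of_int k\<bar> powr - s) has_sum real_zeta s) {..<0}"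
    using pos by (subst has_sum_reindex_bij_witness[of _ uminus uminus "{0<..}" "\<lambda>k. \<bar>real_of_int k\<bar> powr - s"]) auto
  have "((\<lambda>k::int. \<bar>real_of_int k\<bar> powr - s) has_sum (real_zeta s + real_zeta s)) ({0<..} \<union> {..<0})"
    by (intro has_sum_Un_disjoint pos neg) auto
  moreover have "{0<..} \<union> {..<0} = UNIV - {0::int}" by auto
  ultimately show ?thesis by simp
qed

lemma has_sum_prod_int_powr:
  assumes "s > 1" "finite u"
  shows "((\<lambda>g. \<Prod>j\<in>u. \<bar>real_of_int (g j)\<bar> powr - s) has_sum (2 * real_zeta s) ^ card u) (u \<rightarrow>\<^sub>E UNIV - {0})"
proof -
  have 1: "(\<lambda>k::int. \<bar>real_of_int k\<bar> powr - s) summable_on (UNIV - {0})"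
    and 2: "(\<Sum>\<^sub>\<infinity>k\<in>UNIV - {0::int}. \<bar>real_of_int k\<bar> powr - s) = 2 * real_zeta s"
    using has_sum_nonzero_int_powr[OF assms(1)] by (simp_all add: has_sum_iff)
  have "Infinite_Sum.abs_summable_on (\<lambda>g. \<Prod>j\<in>u. \<bar>real_of_int (g j)\<bar> powr - s) (u \<rightarrow>\<^sub>E UNIV - {0})"
    unfolding abs_summable_equivalent using 1 assms(2)
    by (intro abs_summable_on_prod_PiE) (auto simp flip: abs_summable_equivalent)
  then have "(\<lambda>g. \<Prod>j\<in>u. \<bar>real_of_int (g j)\<bar> powr - s) summable_on (u \<rightarrow>\<^sub>E UNIV - {0})"
    by (rule abs_summable_summable)
  moreover from this have "(\<Sum>\<^sub>\<infinity>g\<in>u \<rightarrow>\<^sub>E UNIV - {0}. \<Prod>j\<in>u. \<bar>real_of_int (g j)\<bar> powr - s) = (2 * real_zeta s) ^ card u"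
    using 1 assms(2) by (subst infsum_prod_PiE) (auto simp: 2)
  ultimately show ?thesis by (simp add: has_sum_iff)
qed

text \<open>Extension by zero and restriction to \<open>u\<close> are inverse bijections between
  tuples of nonzero integers on \<open>u\<close> and frequencies with support \<open>u\<close>; over
  such tuples the sum factorises by coordinates.\<close>

lemma has_sum_korobov_r_powr_supp:
  assumes "positive_weights \<gamma>" "\<alpha> / lam > 1" "u \<subseteq> {1..d}"
  shows "((\<lambda>h. korobov_r d \<alpha> \<gamma> h powr (- 1 / lam)) has_sum
     (\<gamma> u powr (1 / lam) * (2 * real_zeta (\<alpha> / lam)) ^ card u)) {h \<in> int_vecs d. supp d h = u}"
proof -
  have "finite u" using assms(3) by (rule finite_subset) simp
  have "((\<lambda>g. \<gamma> u powr (1 / lam) * (\<Prod>j\<in>u. \<bar>real_of_int (g j)\<bar> powr - (\<alpha> / lam))) has_sum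
      (\<gamma> u powr (1 / lam) * (2 * real_zeta (\<alpha> / lam)) ^ card u)) (u \<rightarrow>\<^sub>E UNIV - {0})"
    by (intro has_sum_cmult_right has_sum_prod_int_powr assms(2) \<open>finite u\<close>)
  also have "?this \<longleftrightarrow> ?thesis"
  proof (rule has_sum_reindex_bij_witness[of _ "\<lambda>h. restrict h u" "\<lambda>g. \<lambda>j\<in>{1..d}. if j \<in> u then g j else 0"])
    fix g :: "nat \<Rightarrow> int" assume g: "g \<in> u \<rightarrow>\<^sub>E UNIV - {0}"
    let ?h = "\<lambda>j\<in>{1..d}. if j \<in> u then g j else 0"
    show "restrict ?h u = g"
    proof
      show "restrict ?h u j = g j" for j
        using g assms(3) by (cases "j \<in> u") (auto simp: PiE_iff extensional_def)
    qed
    have supp: "supp d ?h = u"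
      using g assms(3) by (auto simp: supp_def PiE_iff)
    then show "?h \<in> {h \<in> int_vecs d. supp d h = u}" by (auto simp: int_vecs_def)
    have "(\<Prod>j\<in>u. \<bar>real_of_int (?h j)\<bar> powr - (\<alpha> / lam)) = (\<Prod>j\<in>u. \<bar>real_of_int (g j)\<bar> powr - (\<alpha> / lam))"
      using assms(3) by (intro prod.cong) auto
    then show "korobov_r d \<alpha> \<gamma> ?h powr (- 1 / lam) = \<gamma> u powr (1 / lam) * (\<Prod>j\<in>u. \<bar>real_of_int (g j)\<bar> powr - (\<alpha> / lam))"
      unfolding korobov_r_powr[OF assms(1)] supp by simp
  next
    fix h assume h: "h \<in> {h \<in> int_vecs d. supp d h = u}"
    then show "restrict h u \<in> u \<rightarrow>\<^sub>E UNIV - {0}" by (auto simp: supp_def)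
    show "(\<lambda>j\<in>{1..d}. if j \<in> u then restrict h u j else 0) = h"
      using h by (auto simp: fun_eq_iff supp_def int_vecs_def PiE_iff extensional_def)
  qed simp
  finally show ?thesis .
qed

lemma supp_eq_empty_iff:
  assumes "h \<in> int_vecs d"
  shows "supp d h = {} \<longleftrightarrow> h = zero_vec d"
  using assms by (auto simp: supp_def zero_vec_def int_vecs_def fun_eq_iff PiE_iff extensional_def)

lemma has_sum_korobov_r_powr:
  assumes "positive_weights \<gamma>" "\<alpha> / lam > 1"
  shows "((\<lambda>h. korobov_r d \<alpha> \<gamma> h powr (- 1 / lam)) has_sum
     (\<Sum>u\<in>Pow {1..d} - {{}}. \<gamma> u powr (1 / lam) * (2 * real_zeta (\<alpha> / lam)) ^ card u)) (int_vecs d - {zero_vec d})"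
proof -
  have "((\<lambda>h. korobov_r d \<alpha> \<gamma> h powr (- 1 / lam)) has_sum
     (\<Sum>u\<in>Pow {1..d} - {{}}. \<gamma> u powr (1 / lam) * (2 * real_zeta (\<alpha> / lam)) ^ card u))
     (\<Union>u\<in>Pow {1..d} - {{}}. {h \<in> int_vecs d. supp d h = u})"
    using assms by (intro sum_has_sum has_sum_korobov_r_powr_supp) auto
  also have "(\<Union>u\<in>Pow {1..d} - {{}}. {h \<in> int_vecs d. supp d h = u}) = int_vecs d - {zero_vec d}"
  proof -
    have "supp d h \<subseteq> {1..d}" for h by (auto simp: supp_def)
    then show ?thesis using supp_eq_empty_iff[of _ d] by auto
  qed
  finally show ?thesis .
qed

lemma korobov_mu_eq:
  assumes "positive_weights \<gamma>" "\<alpha> / lam > 1"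
  shows "korobov_mu d \<alpha> \<gamma> lam = (\<Sum>u\<in>Pow {1..d} - {{}}. \<gamma> u powr (1 / lam) * (2 * real_zeta (\<alpha> / lam)) ^ card u)"
  unfolding korobov_mu_def using has_sum_korobov_r_powr[OF assms] by (rule infsumI)

lemma korobov_mu_nonneg: "korobov_mu d \<alpha> \<gamma> lam \<ge> 0"
  unfolding korobov_mu_def by (rule infsum_nonneg) simp

text \<open>The multiples of the first unit vector alone suffice. At \<open>lam = \<alpha>\<close>
  their contribution up to \<open>K\<close> is a positive constant times a harmonic number, and for
  fixed \<open>K\<close> it is continuous in \<open>lam\<close>.\<close>

lemma korobov_mu_filterlim:
  assumes \<gamma>: "positive_weights \<gamma>" and "\<alpha> > 1/2" "d \<ge> 1"
  shows "filterlim (\<lambda>lam. korobov_mu d \<alpha> \<gamma> lam) at_top (at_left \<alpha>)"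
  unfolding filterlim_at_top
proof
  fix Z :: real
  define G where "G lam K = (\<Sum>k=1..K. \<gamma> {1} powr (1 / lam) * real k powr (- (\<alpha> / lam)))" for lam K
  have g: "\<gamma> {1} > 0" using \<gamma> by (simp add: positive_weights_def)
  \<comment> \<open>\<open>K\<close> is fixed before \<open>lam\<close> moves. The surplus 1 leaves
    room below the limit at \<open>lam = \<alpha>\<close>.\<close>
  obtain K where K: "harm K > (Z + 1) / \<gamma> {1} powr (1 / \<alpha>)"
  proof -
    have "filterlim (harm :: nat \<Rightarrow> real) at_top sequentially" by (rule harm_at_top)
    then have "eventually (\<lambda>K. harm K > (Z + 1) / \<gamma> {1} powr (1 / \<alpha>)) sequentially"
      by (simp add: filterlim_at_top_dense)
    then show ?thesis using that by (auto dest: eventually_happens)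
  qed
  have "G \<alpha> K = \<gamma> {1} powr (1 / \<alpha>) * harm K"
    using assms(2) by (simp add: G_def harm_def sum_distrib_left powr_minus)
  with K g have "G \<alpha> K > Z + 1" by (simp add: field_simps)
  moreover have "((\<lambda>lam. G lam K) \<longlongrightarrow> G \<alpha> K) (at_left \<alpha>)"
    unfolding G_def using assms(2) g by (intro tendsto_intros) auto
  ultimately have "eventually (\<lambda>lam. G lam K > Z) (at_left \<alpha>)"
    by (intro order_tendstoD(1)) auto
  moreover have "eventually (\<lambda>lam. lam \<in> {0<..<\<alpha>}) (at_left \<alpha>)"
    using assms(2) by (intro eventually_at_leftI[of 0]) auto
  ultimately show "eventually (\<lambda>lam. Z \<le> korobov_mu d \<alpha> \<gamma> lam) (at_left \<alpha>)"
  proof eventually_elim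
    case (elim lam)
    define e where "e k = (\<lambda>j\<in>{1..d}. if j = 1 then int k else 0)" for k
    have e: "e k \<in> int_vecs d - {zero_vec d}" "supp d (e k) = {1}" "e k 1 = int k" if "k \<ge> 1" for k
      using that assms(3) by (auto simp: e_def int_vecs_def zero_vec_def supp_def fun_eq_iff)
    have inj: "inj_on e {1..K}"
    proof (rule inj_onI)
      fix k l assume "k \<in> {1..K}" "l \<in> {1..K}" "e k = e l"
      then show "k = l" using e(3)[of k] e(3)[of l] by simp
    qed
    have "G lam K = (\<Sum>k=1..K. korobov_r d \<alpha> \<gamma> (e k) powr (- 1 / lam))"
      unfolding G_def by (intro sum.cong refl, subst korobov_r_powr[OF \<gamma>]) (simp add: e del: One_nat_def)
    also have "\<dots> = (\<Sum>h\<in>e ` {1..K}. korobov_r d \<alpha> \<gamma> h powr (- 1 / lam))"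
      using inj by (simp add: sum.reindex)
    also have "\<dots> \<le> korobov_mu d \<alpha> \<gamma> lam"
      unfolding korobov_mu_def
    proof (rule finite_sum_le_infsum)
      show "(\<lambda>h. korobov_r d \<alpha> \<gamma> h powr (- 1 / lam)) summable_on int_vecs d - {zero_vec d}"
        using has_sum_korobov_r_powr[OF \<gamma>, of \<alpha> lam d] elim by (auto simp: has_sum_iff)
      show "e ` {1..K} \<subseteq> int_vecs d - {zero_vec d}" using e(1) by auto
    qed simp_all
    finally show ?case using elim by simp
  qed
qed

text \<open>For every \<open>d\<close>, \<open>korobov_mu\<close> is a finite partial sum of one
  nonnegative series over all nonempty finite subsets, so the value of that series is a common
  bound.\<close>

lemma korobov_mu_bounded_dim:
  assumes \<gamma>: "positive_weights \<gamma>" "\<alpha> / lam > 1"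
    and sum: "(\<lambda>u. \<gamma> u powr (1 / lam) * (2 * real_zeta (\<alpha> / lam)) ^ card u)
      summable_on {u. finite u \<and> u \<noteq> {} \<and> u \<subseteq> {1..}}"
  shows "\<exists>M. \<forall>d. korobov_mu d \<alpha> \<gamma> lam \<le> M"
proof (intro exI allI)
  fix d
  have "real_zeta (\<alpha> / lam) \<ge> 0"
    using has_sum_real_zeta[OF assms(2)] by (rule has_sum_nonneg) simp
  then show "korobov_mu d \<alpha> \<gamma> lam \<le> (\<Sum>\<^sub>\<infinity>u\<in>{u. finite u \<and> u \<noteq> {} \<and> u \<subseteq> {1..}}. \<gamma> u powr (1 / lam) * (2 * real_zeta (\<alpha> / lam)) ^ card u)"
    unfolding korobov_mu_eq[OF \<gamma>] using sum
    by (intro finite_sum_le_infsum) (auto intro: finite_subset)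
qed

text \<open>No term exceeds the total S, so x^q \<le> S^(q-1) x termwise. Used with q = 2 lam to
  trade the squared weights for sums that define \<open>korobov_mu\<close>.\<close>

lemma infsum_powr_le:
  fixes x :: "'a \<Rightarrow> real"
  assumes "x summable_on A" "\<And>i. i \<in> A \<Longrightarrow> x i \<ge> 0" "q \<ge> 1"
  shows "(\<lambda>i. x i powr q) summable_on A" "(\<Sum>\<^sub>\<infinity>i\<in>A. x i powr q) \<le> (\<Sum>\<^sub>\<infinity>i\<in>A. x i) powr q"
proof -
  define S where "S = (\<Sum>\<^sub>\<infinity>i\<in>A. x i)"
  have le: "x i powr q \<le> S powr (q - 1) * x i" if "i \<in> A" for i
  proof (cases "x i = 0")
    case False
    then have "x i > 0" using assms(2)[OF that] by simp
    have "x i \<le> S"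
      using finite_sum_le_infsum[OF assms(1), of "{i}"] that assms(2) by (simp add: S_def)
    then have "x i powr (q - 1) * x i \<le> S powr (q - 1) * x i"
      using \<open>x i > 0\<close> assms(3) by (intro mult_right_mono powr_mono2) auto
    moreover have "x i powr q = x i powr (q - 1) * x i"
      using \<open>x i > 0\<close> powr_add[of "x i" "q - 1" 1] by simp
    ultimately show ?thesis by simp
  qed simp
  have sum: "(\<lambda>i. S powr (q - 1) * x i) summable_on A" using assms(1) by (rule summable_on_cmult_right)
  show 1: "(\<lambda>i. x i powr q) summable_on A"
    using sum by (rule summable_on_comparison_test) (auto simp: le)
  have "(\<Sum>\<^sub>\<infinity>i\<in>A. x i powr q) \<le> (\<Sum>\<^sub>\<infinity>i\<in>A. S powr (q - 1) * x i)"
    using 1 sum le by (rule infsum_mono)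
  also have "\<dots> = S powr (q - 1) * S" by (simp add: infsum_cmult_right' S_def)
  also have "S \<ge> 0" unfolding S_def by (rule infsum_nonneg) (rule assms(2))
  then have "S powr (q - 1) * S = S powr q"
    using powr_add[of S "q - 1" 1] by (cases "S = 0") auto
  finally show "(\<Sum>\<^sub>\<infinity>i\<in>A. x i powr q) \<le> (\<Sum>\<^sub>\<infinity>i\<in>A. x i) powr q" by (simp add: S_def)
qed

text \<open>For these frequencies \<open>m\<close> divides the dot product with every vector, so no
  averaging helps; instead their weight is small. Writing h = m k, each nonzero coordinate
  contributes a factor m powr (- \<alpha> / lam) \<le> 1/m, and there is at least one such
  coordinate.\<close>

lemma korobov_mu_multiples:
  fixes d m :: nat
  assumes \<gamma>: "positive_weights \<gamma>" and lam: "0 < lam" "lam < \<alpha>" and "m > 0"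
  defines "D \<equiv> {h \<in> int_vecs d - {zero_vec d}. \<forall>j\<in>{1..d}. int m dvd h j}"
  shows "(\<Sum>\<^sub>\<infinity>h\<in>D. korobov_r d \<alpha> \<gamma> h powr (- 1 / lam)) \<le> korobov_mu d \<alpha> \<gamma> lam / real m"
proof -
  let ?H = "int_vecs d - {zero_vec d}"
  let ?a = "\<lambda>h. korobov_r d \<alpha> \<gamma> h powr (- 1 / lam)"
  define s where "s h = (\<lambda>j\<in>{1..d}. int m * h j)" for h :: "nat \<Rightarrow> int"
  have summable: "?a summable_on ?H"
    using has_sum_korobov_r_powr[OF \<gamma>, of \<alpha> lam d] lam by (auto simp: has_sum_iff)
  have s_vec: "s h \<in> int_vecs d" for h by (simp add: s_def int_vecs_def)
  have supp_s: "supp d (s h) = supp d h" for h using \<open>m > 0\<close> by (auto simp: supp_def s_def)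
  have le: "?a (s h) \<le> ?a h * (1 / real m)" if h: "h \<in> ?H" for h
  proof -
    have "supp d h \<noteq> {}"
      using h supp_eq_empty_iff[of h d] by simp
    then have "card (supp d h) \<ge> 1" by (simp add: Suc_le_eq card_gt_0_iff supp_def)
    have "(\<Prod>j\<in>supp d h. \<bar>real_of_int (s h j)\<bar> powr (- (\<alpha> / lam)))
        = (\<Prod>j\<in>supp d h. real m powr (- (\<alpha> / lam)) * \<bar>real_of_int (h j)\<bar> powr (- (\<alpha> / lam)))"
      by (intro prod.cong) (auto simp: s_def supp_def abs_mult powr_mult)
    also have "\<dots> = (real m powr (- (\<alpha> / lam))) ^ card (supp d h) * (\<Prod>j\<in>supp d h. \<bar>real_of_int (h j)\<bar> powr (- (\<alpha> / lam)))"
      by (simp add: prod.distrib)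
    also have "\<dots> \<le> (1 / real m) * (\<Prod>j\<in>supp d h. \<bar>real_of_int (h j)\<bar> powr (- (\<alpha> / lam)))"
    proof (intro mult_right_mono prod_nonneg ballI powr_ge_zero)
      have "real m powr (- (\<alpha> / lam)) \<le> real m powr (- 1)"
        using lam \<open>m > 0\<close> by (intro powr_mono) (auto simp: field_simps)
      also have "\<dots> = 1 / real m" using \<open>m > 0\<close> by (simp add: powr_minus_divide)
      finally have *: "real m powr (- (\<alpha> / lam)) \<le> 1 / real m" .
      have "(real m powr (- (\<alpha> / lam))) ^ card (supp d h) \<le> (1 / real m) ^ card (supp d h)"
        using * by (intro power_mono) auto
      also have "\<dots> \<le> (1 / real m) ^ 1"
        using \<open>m > 0\<close> \<open>card (supp d h) \<ge> 1\<close> by (intro power_decreasing) auto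
      finally show "(real m powr (- (\<alpha> / lam))) ^ card (supp d h) \<le> 1 / real m" by simp
    qed
    finally have "\<gamma> (supp d h) powr (1 / lam) * (\<Prod>j\<in>supp d h. \<bar>real_of_int (s h j)\<bar> powr (- (\<alpha> / lam)))
        \<le> \<gamma> (supp d h) powr (1 / lam) * ((1 / real m) * (\<Prod>j\<in>supp d h. \<bar>real_of_int (h j)\<bar> powr (- (\<alpha> / lam))))"
      by (rule mult_left_mono) simp
    then show ?thesis unfolding korobov_r_powr[OF \<gamma>] supp_s by (simp add: mult_ac)
  qed
  have "(\<Sum>\<^sub>\<infinity>h\<in>D. ?a h) = (\<Sum>\<^sub>\<infinity>h\<in>?H. ?a (s h))"
  proof (rule infsum_reindex_bij_witness[of _ s "\<lambda>h. \<lambda>j\<in>{1..d}. h j div int m"])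
    fix h assume "h \<in> ?H"
    then have "s h \<noteq> zero_vec d"
      using supp_eq_empty_iff[of h d] supp_eq_empty_iff[of "s h" d] s_vec[of h] by (auto simp: supp_s)
    then show "s h \<in> D" using s_vec[of h] by (simp add: D_def s_def)
    show "(\<lambda>j\<in>{1..d}. s h j div int m) = h"
      using \<open>h \<in> ?H\<close> \<open>m > 0\<close> by (intro ext) (auto simp: s_def int_vecs_def PiE_iff extensional_def)
  next
    fix h assume h: "h \<in> D"
    show *: "s (\<lambda>j\<in>{1..d}. h j div int m) = h"
      using h by (intro ext) (auto simp: s_def D_def int_vecs_def PiE_iff extensional_def)
    have "(\<lambda>j\<in>{1..d}. h j div int m) \<in> int_vecs d" by (simp add: int_vecs_def)
    moreover have "supp d (\<lambda>j\<in>{1..d}. h j div int m) \<noteq> {}"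
      using supp_s[of "\<lambda>j\<in>{1..d}. h j div int m"] supp_eq_empty_iff[of h d] h unfolding * by (simp add: D_def)
    ultimately show "(\<lambda>j\<in>{1..d}. h j div int m) \<in> ?H"
      using supp_eq_empty_iff by simp
    show "?a (s (\<lambda>j\<in>{1..d}. h j div int m)) = ?a h" by (simp only: *)
  qed
  also have "\<dots> \<le> (\<Sum>\<^sub>\<infinity>h\<in>?H. ?a h * (1 / real m))"
  proof (rule infsum_mono)
    show *: "(\<lambda>h. ?a h * (1 / real m)) summable_on ?H" using summable by (rule summable_on_cmult_left)
    show "(\<lambda>h. ?a (s h)) summable_on ?H"
      by (rule summable_on_comparison_test[OF *], erule le) simp
  qed (rule le)
  also have "\<dots> = korobov_mu d \<alpha> \<gamma> lam / real m"
    unfolding infsum_cmult_left' korobov_mu_def by simp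
  finally show ?thesis .
qed

section \<open>Averaging over good generating vectors\<close>

definition residue_vecs :: "nat \<Rightarrow> nat \<Rightarrow> (nat \<Rightarrow> int) set" where
  "residue_vecs d p = {1..d} \<rightarrow>\<^sub>E {0..<int p}"

lemma finite_residue_vecs [simp]: "finite (residue_vecs d p)"
  unfolding residue_vecs_def by (intro finite_PiE) auto

lemma card_residue_vecs: "card (residue_vecs d p) = p ^ d"
  by (simp add: residue_vecs_def card_PiE)

text \<open>If \<open>p\<close> does not divide \<open>h j\<close>, the divisibility condition
  determines \<open>z j\<close> modulo \<open>p\<close> from the other coordinates, so forgetting
  coordinate \<open>j\<close> is injective on the solutions.\<close>

lemma card_residue_vecs_dual_le:
  assumes "prime p" "\<not> (\<forall>j\<in>{1..d}. int p dvd h j)"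
  shows "card {z \<in> residue_vecs d p. int p dvd dotp d h z} * p \<le> p ^ d"
proof -
  obtain j where j: "j \<in> {1..d}" "\<not> int p dvd h j" using assms(2) by blast
  define I where "I = {1..d} - {j}"
  define A where "A = {z \<in> residue_vecs d p. int p dvd dotp d h z}"
  have "inj_on (\<lambda>z. restrict z I) A"
  proof (rule inj_onI)
    fix z z' assume z: "z \<in> A" "z' \<in> A" "restrict z I = restrict z' I"
    have eq: "z i = z' i" if "i \<in> I" for i using z(3) that by (metis restrict_apply')
    have "dotp d h z - dotp d h z' = h j * z j - h j * z' j"
    proof -
      have "dotp d h v = h j * v j + (\<Sum>i\<in>I. h i * v i)" for v
        unfolding dotp_def I_def using j(1) by (intro sum.remove) auto
      moreover have "(\<Sum>i\<in>I. h i * z i) = (\<Sum>i\<in>I. h i * z' i)"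
        by (intro sum.cong) (simp_all add: eq)
      ultimately show ?thesis by simp
    qed
    then have "int p dvd h j * (z j - z' j)"
      using z(1,2) by (metis (no_types, lifting) A_def dvd_diff mem_Collect_eq right_diff_distrib)
    then have "int p dvd z j - z' j"
      using assms(1) j(2) by (simp add: prime_dvd_mult_iff)
    moreover have "z j \<in> {0..<int p}" "z' j \<in> {0..<int p}"
      using z(1,2) j(1) by (auto simp: A_def residue_vecs_def PiE_iff)
    ultimately have "z j = z' j"
      by (metis atLeastLessThan_iff mod_eq_dvd_iff mod_pos_pos_trivial)
    then show "z = z'"
      using z(1,2) eq by (intro PiE_ext[of z "{1..d}" "\<lambda>_. {0..<int p}"]) (auto simp: A_def residue_vecs_def I_def)
  qed
  moreover have "(\<lambda>z. restrict z I) ` A \<subseteq> I \<rightarrow>\<^sub>E {0..<int p}"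
  proof (rule image_subsetI)
    fix z assume "z \<in> A"
    then have "\<forall>i\<in>I. z i \<in> {0..<int p}" by (auto simp: A_def residue_vecs_def I_def PiE_iff)
    then show "restrict z I \<in> I \<rightarrow>\<^sub>E {0..<int p}" by (simp only: restrict_PiE_iff)
  qed
  ultimately have "card A \<le> card (I \<rightarrow>\<^sub>E {0..<int p})"
    by (intro card_inj_on_le[of "\<lambda>z. restrict z I"] finite_PiE) (auto simp: I_def)
  also have "\<dots> = p ^ (d - 1)" using j(1) by (simp add: card_PiE I_def)
  finally have "card A * p \<le> p ^ (d - 1) * p" by (rule mult_right_mono) simp
  also have "\<dots> = p ^ d" using j(1) by (cases d) auto
  finally show ?thesis unfolding A_def .
qed

text \<open>Independence in counting form: for a uniformly random choice function, constraints at
  distinct indices have a joint probability equal to the product of the individual ones.\<close>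

lemma card_PiE_constrained:
  fixes G :: "'p \<Rightarrow> 'z set"
  assumes "finite P" "Q \<subseteq> P" "\<And>p. p \<in> P \<Longrightarrow> finite (G p)" "\<And>p. p \<in> P \<Longrightarrow> G p \<noteq> {}"
  shows "real (card {F \<in> Pi\<^sub>E P G. \<forall>p\<in>Q. C p (F p)})
    = real (card (Pi\<^sub>E P G)) * (\<Prod>p\<in>Q. real (card {z \<in> G p. C p z}) / real (card (G p)))"
proof -
  have "{F \<in> Pi\<^sub>E P G. \<forall>p\<in>Q. C p (F p)} = Pi\<^sub>E P (\<lambda>p. if p \<in> Q then {z \<in> G p. C p z} else G p)"
  proof (rule Set.set_eqI)
    fix F
    have "F i \<in> (if i \<in> Q then {z \<in> G i. C i z} else G i) \<longleftrightarrow> F i \<in> G i \<and> (i \<in> Q \<longrightarrow> C i (F i))" for i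
      by auto
    then show "F \<in> {F \<in> Pi\<^sub>E P G. \<forall>p\<in>Q. C p (F p)} \<longleftrightarrow>
        F \<in> Pi\<^sub>E P (\<lambda>p. if p \<in> Q then {z \<in> G p. C p z} else G p)"
      using assms(2) unfolding PiE_iff mem_Collect_eq by blast
  qed
  then have "real (card {F \<in> Pi\<^sub>E P G. \<forall>p\<in>Q. C p (F p)})
      = (\<Prod>p\<in>P. real (card (if p \<in> Q then {z \<in> G p. C p z} else G p)))"
    using assms(1) by (simp add: card_PiE)
  also have "\<dots> = (\<Prod>p\<in>P. real (card (G p)) * (if p \<in> Q then real (card {z \<in> G p. C p z}) / real (card (G p)) else 1))"
    using assms(3,4) by (intro prod.cong) (auto simp: card_gt_0_iff)
  also have "\<dots> = real (card (Pi\<^sub>E P G)) * (\<Prod>p\<in>P. if p \<in> Q then real (card {z \<in> G p. C p z}) / real (card (G p)) else 1)"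
    using assms(1) by (simp add: prod.distrib card_PiE)
  also have "(\<Prod>p\<in>P. if p \<in> Q then real (card {z \<in> G p. C p z}) / real (card (G p)) else 1)
      = (\<Prod>p\<in>Q. real (card {z \<in> G p. C p z}) / real (card (G p)))"
    using assms(1,2) by (simp add: prod.If_cases Int_absorb1)
  finally show ?thesis .
qed

lemma summable_on_sum:
  fixes f :: "'b \<Rightarrow> 'a \<Rightarrow> 'c::topological_comm_monoid_add"
  assumes "\<And>i. i \<in> I \<Longrightarrow> f i summable_on A"
  shows "(\<lambda>x. \<Sum>i\<in>I. f i x) summable_on A"
  using assms by (induction I rule: infinite_finite_induct) (auto intro: summable_on_add)

lemma infsum_sum_swap:
  fixes f :: "'b \<Rightarrow> 'a \<Rightarrow> real"
  assumes "\<And>i. i \<in> I \<Longrightarrow> f i summable_on A"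
  shows "(\<Sum>i\<in>I. \<Sum>\<^sub>\<infinity>x\<in>A. f i x) = (\<Sum>\<^sub>\<infinity>x\<in>A. \<Sum>i\<in>I. f i x)"
proof -
  have "((\<lambda>x. \<Sum>i\<in>I. f i x) has_sum (\<Sum>i\<in>I. \<Sum>\<^sub>\<infinity>x\<in>A. f i x)) A"
    using assms by (intro has_sum_sum has_sum_infsum)
  then show ?thesis by (simp add: infsumI)
qed

locale korobov =
  fixes d :: nat and \<alpha> :: real and \<gamma> :: "nat set \<Rightarrow> real"
  assumes pos: "positive_weights \<gamma>" and \<alpha>: "\<alpha> > 1/2"
begin

abbreviation H :: "(nat \<Rightarrow> int) set" where "H \<equiv> int_vecs d - {zero_vec d}"

text \<open>The inverse squared Korobov weight in \<open>powr\<close> form, so that it is the power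
  2 lam of \<open>a lam\<close> for every nonzero \<open>lam\<close>, and equals
  \<open>a (1/2)\<close>.\<close>

definition w :: "(nat \<Rightarrow> int) \<Rightarrow> real" where
  "w h = korobov_r d \<alpha> \<gamma> h powr - 2"

definition a :: "real \<Rightarrow> (nat \<Rightarrow> int) \<Rightarrow> real" where
  "a lam h = korobov_r d \<alpha> \<gamma> h powr (- 1 / lam)"

abbreviation \<mu> :: "real \<Rightarrow> real" where "\<mu> lam \<equiv> korobov_mu d \<alpha> \<gamma> lam"

text \<open>The squared worst-case error of the lattice rule.\<close>

definition e2 :: "nat \<Rightarrow> (nat \<Rightarrow> int) \<Rightarrow> real" where
  "e2 p z = (\<Sum>\<^sub>\<infinity>h\<in>dual_lattice d p z. w h)"

lemma r_pos: "korobov_r d \<alpha> \<gamma> h > 0"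
  by (rule korobov_r_pos[OF pos])

lemma w_nonneg [simp]: "w h \<ge> 0" and a_nonneg [simp]: "a lam h \<ge> 0"
  by (simp_all add: w_def a_def)

lemma a_powr: "lam \<noteq> 0 \<Longrightarrow> a lam h powr (2 * lam) = w h"
  by (simp add: w_def a_def powr_powr)

lemma summable_a: "0 < lam \<Longrightarrow> lam < \<alpha> \<Longrightarrow> a lam summable_on H"
  using has_sum_korobov_r_powr[OF pos, of \<alpha> lam d] by (auto simp: has_sum_iff a_def[abs_def])

lemma infsum_a: "(\<Sum>\<^sub>\<infinity>h\<in>H. a lam h) = \<mu> lam"
  by (simp add: a_def korobov_mu_def)

lemma summable_w: "w summable_on H"
proof -
  have "w = a (1/2)" by (simp add: fun_eq_iff w_def a_def)
  then show ?thesis using summable_a[of "1/2"] \<alpha> by simp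
qed

lemma summable_w_bounded:
  assumes "\<And>h. h \<in> H \<Longrightarrow> 0 \<le> c h" "\<And>h. h \<in> H \<Longrightarrow> c h \<le> B"
  shows "(\<lambda>h. w h * c h) summable_on H"
  using summable_on_cmult_left[OF summable_w, of B]
  by (rule summable_on_comparison_test) (auto intro!: mult_left_mono mult_nonneg_nonneg assms)

lemma infsum_w_le:
  assumes "A \<subseteq> H" "1/2 \<le> lam" "lam < \<alpha>"
  shows "(\<Sum>\<^sub>\<infinity>h\<in>A. w h) \<le> (\<Sum>\<^sub>\<infinity>h\<in>A. a lam h) powr (2 * lam)"
proof -
  have "(\<Sum>\<^sub>\<infinity>h\<in>A. a lam h powr (2 * lam)) \<le> (\<Sum>\<^sub>\<infinity>h\<in>A. a lam h) powr (2 * lam)"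
    using assms by (intro infsum_powr_le summable_on_subset[OF summable_a assms(1)]) auto
  then show ?thesis using assms by (simp add: a_powr)
qed

lemma infsum_dual_eq:
  fixes x :: "(nat \<Rightarrow> int) \<Rightarrow> real"
  shows "(\<Sum>\<^sub>\<infinity>h\<in>dual_lattice d p z. x h) = (\<Sum>\<^sub>\<infinity>h\<in>H. x h * of_bool (int p dvd dotp d h z))"
  by (rule infsum_cong_neutral) (auto simp: dual_lattice_def)

lemma sum_infsum_dual:
  fixes x :: "(nat \<Rightarrow> int) \<Rightarrow> real"
  assumes "x summable_on H" "\<And>h. x h \<ge> 0" "finite Z"
  shows "(\<Sum>z\<in>Z. \<Sum>\<^sub>\<infinity>h\<in>dual_lattice d p z. x h) = (\<Sum>\<^sub>\<infinity>h\<in>H. x h * real (card {z\<in>Z. int p dvd dotp d h z}))"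
proof -
  have "(\<Sum>z\<in>Z. \<Sum>\<^sub>\<infinity>h\<in>dual_lattice d p z. x h) = (\<Sum>\<^sub>\<infinity>h\<in>H. \<Sum>z\<in>Z. x h * of_bool (int p dvd dotp d h z))"
    unfolding infsum_dual_eq
    by (rule infsum_sum_swap, rule summable_on_comparison_test[OF assms(1)]) (auto simp: assms(2))
  then show ?thesis using assms(3) by (simp add: Int_def flip: sum_distrib_left)
qed

text \<open>The mean over all residues is at most 2 \<mu> / p. A frequency with a coordinate not
  divisible by \<open>p\<close> is hit by at most a proportion 1/p of the residues; the other
  frequencies are always hit, but their weight is at most \<mu> / p by
  \<open>korobov_mu_multiples\<close>.\<close>

lemma sum_dual_a_le:
  assumes "prime p" "1/2 \<le> lam" "lam < \<alpha>"
  shows "(\<Sum>z\<in>residue_vecs d p. \<Sum>\<^sub>\<infinity>h\<in>dual_lattice d p z. a lam h) \<le> 2 * real p ^ d * \<mu> lam / real p"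
proof -
  define D where "D = {h \<in> H. \<forall>j\<in>{1..d}. int p dvd h j}"
  have "p > 0" using assms(1) by (rule prime_gt_0_nat)
  have sa: "a lam summable_on H" using assms by (intro summable_a) auto
  define N where "N h = real (card {z\<in>residue_vecs d p. int p dvd dotp d h z})" for h
  have N: "N h \<le> real p ^ d / real p + real p ^ d * of_bool (h \<in> D)" if "h \<in> H" for h
  proof (cases "h \<in> D")
    case True
    have "card {z\<in>residue_vecs d p. int p dvd dotp d h z} \<le> card (residue_vecs d p)"
      by (intro card_mono) auto
    then have "N h \<le> real (p ^ d)" unfolding N_def card_residue_vecs by (rule of_nat_mono)
    then show ?thesis using True by (simp add: add_increasing)
  next
    case False
    then have "card {z\<in>residue_vecs d p. int p dvd dotp d h z} * p \<le> p ^ d"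
      using that by (intro card_residue_vecs_dual_le assms(1)) (auto simp: D_def)
    then have "N h * real p \<le> real p ^ d" unfolding N_def by (metis of_nat_le_iff of_nat_mult of_nat_power)
    then show ?thesis using False \<open>p > 0\<close> by (simp add: field_simps)
  qed
  have s1: "(\<lambda>h. a lam h * (real p ^ d / real p)) summable_on H" using sa by (rule summable_on_cmult_left)
  have s2: "(\<lambda>h. a lam h * (real p ^ d * of_bool (h \<in> D))) summable_on H"
    using summable_on_cmult_left[OF sa, of "real p ^ d"] by (rule summable_on_comparison_test) auto
  have s3: "(\<lambda>h. a lam h * (real p ^ d / real p) + a lam h * (real p ^ d * of_bool (h \<in> D))) summable_on H"
    using s1 s2 by (rule summable_on_add)
  have le: "a lam h * N h \<le> a lam h * (real p ^ d / real p) + a lam h * (real p ^ d * of_bool (h \<in> D))" if "h \<in> H" for h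
    using mult_left_mono[OF N[OF that], of "a lam h"] by (simp only: distrib_left a_nonneg)
  have "(\<Sum>z\<in>residue_vecs d p. \<Sum>\<^sub>\<infinity>h\<in>dual_lattice d p z. a lam h) = (\<Sum>\<^sub>\<infinity>h\<in>H. a lam h * N h)"
    unfolding N_def by (intro sum_infsum_dual sa) auto
  also have "\<dots> \<le> (\<Sum>\<^sub>\<infinity>h\<in>H. a lam h * (real p ^ d / real p) + a lam h * (real p ^ d * of_bool (h \<in> D)))"
  proof (rule infsum_mono[OF _ s3 le])
    show "(\<lambda>h. a lam h * N h) summable_on H"
      by (rule summable_on_comparison_test[OF s3], erule le) (simp add: N_def)
  qed
  also have "\<dots> = (\<Sum>\<^sub>\<infinity>h\<in>H. a lam h * (real p ^ d / real p)) + (\<Sum>\<^sub>\<infinity>h\<in>H. a lam h * (real p ^ d * of_bool (h \<in> D)))"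
    using s1 s2 by (rule infsum_add)
  also have "(\<Sum>\<^sub>\<infinity>h\<in>H. a lam h * (real p ^ d / real p)) = \<mu> lam * (real p ^ d / real p)"
    by (simp only: infsum_cmult_left' infsum_a)
  also have "(\<Sum>\<^sub>\<infinity>h\<in>H. a lam h * (real p ^ d * of_bool (h \<in> D))) = (\<Sum>\<^sub>\<infinity>h\<in>D. a lam h * real p ^ d)"
    by (rule infsum_cong_neutral) (auto simp: D_def)
  also have "\<dots> = (\<Sum>\<^sub>\<infinity>h\<in>D. a lam h) * real p ^ d" by (rule infsum_cmult_left')
  also have "\<dots> \<le> \<mu> lam / real p * real p ^ d"
    unfolding D_def a_def using assms \<open>p > 0\<close> pos by (intro mult_right_mono korobov_mu_multiples) auto
  finally show ?thesis by simp
qed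

text \<open>The factor 4 is twice the mean bound of \<open>sum_dual_a_le\<close>, so that Markov's
  inequality leaves at least half of the residues.\<close>

definition good :: "nat \<Rightarrow> (nat \<Rightarrow> int) set" where
  "good p = {z \<in> residue_vecs d p. \<forall>lam\<in>{1/2..<\<alpha>}. e2 p z \<le> (4 * \<mu> lam / real p) powr (2 * lam)}"

lemma finite_good [simp]: "finite (good p)"
  unfolding good_def by simp

text \<open>Among the bad vectors, the one with the smallest worst-case error violates the bound for some
  \<open>lam\<close>; for this single \<open>lam\<close> all bad vectors do, so that Markov's inequality applies.\<close>

lemma card_good:
  assumes "prime p"
  shows "p ^ d \<le> 2 * card (good p)"
proof -
  define B where "B = residue_vecs d p - good p"
  have "finite B" by (simp add: B_def)
  have "2 * card B \<le> p ^ d"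
  proof (cases "B = {}")
    case False
    obtain z0 where z0: "z0 \<in> B" "\<And>z. z \<in> B \<Longrightarrow> e2 p z0 \<le> e2 p z"
      using ex_is_arg_min_if_finite[OF \<open>finite B\<close> False, of "e2 p"] by (auto simp: is_arg_min_linorder)
    then obtain lam where lam: "1/2 \<le> lam" "lam < \<alpha>" "(4 * \<mu> lam / real p) powr (2 * lam) < e2 p z0"
      by (auto simp: B_def good_def not_le)
    define S where "S z = (\<Sum>\<^sub>\<infinity>h\<in>dual_lattice d p z. a lam h)" for z
    have S: "4 * \<mu> lam / real p < S z" if "z \<in> B" for z
    proof (rule ccontr)
      assume "\<not> ?thesis"
      moreover have "S z \<ge> 0" unfolding S_def by (rule infsum_nonneg) simp
      ultimately have "S z powr (2 * lam) \<le> (4 * \<mu> lam / real p) powr (2 * lam)"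
        using lam by (intro powr_mono2) auto
      moreover have "e2 p z \<le> S z powr (2 * lam)"
        unfolding e2_def S_def using lam by (intro infsum_w_le) (auto simp: dual_lattice_def)
      ultimately show False using z0(2)[OF that] lam(3) by linarith
    qed
    have "real (card B) * (4 * \<mu> lam / real p) < (\<Sum>z\<in>B. S z)"
      using sum_strict_mono[OF \<open>finite B\<close> False S] by simp
    also have "\<dots> \<le> (\<Sum>z\<in>residue_vecs d p. S z)"
      unfolding S_def by (intro sum_mono2) (auto simp: B_def intro!: infsum_nonneg)
    also have "\<dots> \<le> 2 * real p ^ d * \<mu> lam / real p"
      unfolding S_def using assms lam by (intro sum_dual_a_le)
    finally have "(2 * \<mu> lam / real p) * (2 * real (card B)) < (2 * \<mu> lam / real p) * real p ^ d"
      by (simp add: mult_ac)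
    \<comment> \<open>Strictness of the previous inequality replaces a proof that \<mu> is positive:
      cancelling needs only a nonnegative factor.\<close>
    then have "2 * real (card B) < real p ^ d"
      by (rule mult_left_less_imp_less) (simp add: korobov_mu_nonneg)
    then show ?thesis by (metis of_nat_le_iff of_nat_mult of_nat_numeral of_nat_power less_imp_le)
  qed simp
  moreover have "card B = p ^ d - card (good p)"
    unfolding B_def by (subst card_Diff_subset) (auto simp: card_residue_vecs good_def)
  ultimately show ?thesis by linarith
qed

lemma good_nonempty:
  assumes "prime p"
  shows "good p \<noteq> {}"
proof
  assume "good p = {}"
  then have "p ^ d \<le> 0" using card_good[OF assms] by simp
  then show False using prime_gt_0_nat[OF assms] by simp
qed

text \<open>The probability that a uniformly random good residue vector modulo \<open>p\<close> has
  \<open>h\<close> in its dual lattice.\<close>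

definition T :: "nat \<Rightarrow> (nat \<Rightarrow> int) \<Rightarrow> real" where
  "T p h = real (card {z \<in> good p. int p dvd dotp d h z}) / real (card (good p))"

lemma T_nonneg: "T p h \<ge> 0" and T_le_1: "T p h \<le> 1"
proof -
  have "card {z \<in> good p. int p dvd dotp d h z} \<le> card (good p)" by (intro card_mono) auto
  then show "T p h \<ge> 0" "T p h \<le> 1" unfolding T_def by (auto simp: divide_le_eq_1)
qed

text \<open>Among all residues the probability is at most 1/p; conditioning on the good ones, at
  least half of all, can at most double it.\<close>

lemma T_le:
  assumes "prime p" "\<not> (\<forall>j\<in>{1..d}. int p dvd h j)"
  shows "T p h \<le> 2 / real p"
proof -
  have "p > 0" using assms(1) by (rule prime_gt_0_nat)
  have "card {z \<in> good p. int p dvd dotp d h z} * p \<le> card {z \<in> residue_vecs d p. int p dvd dotp d h z} * p"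
    by (intro mult_right_mono card_mono) (auto simp: good_def)
  also have "\<dots> \<le> p ^ d" by (rule card_residue_vecs_dual_le[OF assms])
  also have "\<dots> \<le> 2 * card (good p)" by (rule card_good[OF assms(1)])
  finally have "real (card {z \<in> good p. int p dvd dotp d h z}) * real p \<le> 2 * real (card (good p))"
    by (metis of_nat_le_iff of_nat_mult of_nat_numeral)
  moreover have "card (good p) > 0" using good_nonempty[OF assms(1)] by (simp add: card_gt_0_iff)
  ultimately show ?thesis using \<open>p > 0\<close> by (simp add: T_def field_simps)
qed

text \<open>The left side is the average of \<open>e2 p\<close> over the good residues, each of
  which obeys the bound. This preserves the exponent 2 lam, unlike a termwise use of
  \<open>T_le\<close>.\<close>

lemma infsum_w_T_le:
  assumes "prime p" "1/2 \<le> lam" "lam < \<alpha>"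
  shows "(\<Sum>\<^sub>\<infinity>h\<in>H. w h * T p h) \<le> (4 * \<mu> lam / real p) powr (2 * lam)"
proof -
  have c: "card (good p) > 0" using good_nonempty[OF assms(1)] by (simp add: card_gt_0_iff)
  have eq: "(\<Sum>\<^sub>\<infinity>h\<in>H. w h * T p h) = (\<Sum>\<^sub>\<infinity>h\<in>H. w h * real (card {z \<in> good p. int p dvd dotp d h z})) / real (card (good p))"
    unfolding T_def by (simp add: divide_inverse infsum_cmult_left' flip: mult.assoc)
  have "(\<Sum>\<^sub>\<infinity>h\<in>H. w h * real (card {z \<in> good p. int p dvd dotp d h z})) = (\<Sum>z\<in>good p. e2 p z)"
    unfolding e2_def by (rule sum_infsum_dual[symmetric]) (auto simp: summable_w)
  also have "\<dots> \<le> real (card (good p)) * (4 * \<mu> lam / real p) powr (2 * lam)"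
    using assms(2,3) by (intro sum_bounded_above) (auto simp: good_def)
  finally show ?thesis unfolding eq using c by (simp add: pos_divide_le_eq mult.commute)
qed

lemma infsum_w_multiples_le:
  assumes "m > 0" "1/2 \<le> lam" "lam < \<alpha>"
  shows "(\<Sum>\<^sub>\<infinity>h\<in>{h\<in>H. \<forall>j\<in>{1..d}. int m dvd h j}. w h) \<le> (\<mu> lam / real m) powr (2 * lam)"
proof -
  let ?D = "{h\<in>H. \<forall>j\<in>{1..d}. int m dvd h j}"
  have "(\<Sum>\<^sub>\<infinity>h\<in>?D. w h) \<le> (\<Sum>\<^sub>\<infinity>h\<in>?D. a lam h) powr (2 * lam)"
    using assms by (intro infsum_w_le) auto
  also have "\<dots> \<le> (\<mu> lam / real m) powr (2 * lam)"
    unfolding a_def using assms pos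
    by (intro powr_mono2 korobov_mu_multiples infsum_nonneg) auto
  finally show ?thesis .
qed

lemma infsum_w_T_T_le:
  assumes "prime p" "prime q" "p \<noteq> q" "1/2 \<le> lam" "lam < \<alpha>"
  shows "(\<Sum>\<^sub>\<infinity>h\<in>H. w h * (T p h * T q h))
    \<le> 2 / real p * (4 * \<mu> lam / real q) powr (2 * lam) + 2 / real q * (4 * \<mu> lam / real p) powr (2 * lam)
      + (\<mu> lam / (real p * real q)) powr (2 * lam)"
proof -
  have "p > 0" "q > 0" using assms(1,2) prime_gt_0_nat by auto
  define D where "D = {h\<in>H. \<forall>j\<in>{1..d}. int (p * q) dvd h j}"
  have cop: "coprime (int p) (int q)" using assms(1-3) by (simp add: primes_coprime)
  have TT: "T p h * T q h \<le> 2 / real p * T q h + 2 / real q * T p h + of_bool (h \<in> D)" if "h \<in> H" for h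
  proof -
    consider "\<not> (\<forall>j\<in>{1..d}. int p dvd h j)" | "\<not> (\<forall>j\<in>{1..d}. int q dvd h j)" | "h \<in> D"
    proof (cases "(\<forall>j\<in>{1..d}. int p dvd h j) \<and> (\<forall>j\<in>{1..d}. int q dvd h j)")
      case True
      then have "\<forall>j\<in>{1..d}. int p * int q dvd h j" using divides_mult[OF _ _ cop] by blast
      then show ?thesis using \<open>h \<in> H\<close> by (intro that(3)) (simp add: D_def)
    qed (use that in blast)
    then show ?thesis
    proof cases
      case 1
      then have "T p h * T q h \<le> 2 / real p * T q h"
        by (intro mult_right_mono T_le assms T_nonneg)
      then show ?thesis using T_nonneg[of p h] by (intro add_increasing2) auto
    next
      case 2
      then have "T p h * T q h \<le> T p h * (2 / real q)"
        by (intro mult_left_mono T_le assms T_nonneg)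
      moreover have "0 \<le> 2 / real p * T q h" using T_nonneg[of q h] by simp
      ultimately show ?thesis by (simp add: mult.commute of_bool_def)
    next
      case 3
      have "T p h * T q h \<le> 1 * 1" by (intro mult_mono T_le_1 T_nonneg) auto
      moreover have "0 \<le> 2 / real p * T q h" "0 \<le> 2 / real q * T p h" using T_nonneg by simp_all
      ultimately show ?thesis using 3 by simp
    qed
  qed
  have s: "(\<lambda>h. w h * T r h) summable_on H" for r
    by (rule summable_w_bounded[of _ 1]) (simp_all add: T_nonneg T_le_1)
  have s1: "(\<lambda>h. c * (w h * T r h)) summable_on H" for c r using s by (rule summable_on_cmult_right)
  have s2: "(\<lambda>h. w h * of_bool (h \<in> D)) summable_on H" by (rule summable_w_bounded[of _ 1]) auto
  let ?f = "\<lambda>h. 2 / real p * (w h * T q h)" and ?g = "\<lambda>h. 2 / real q * (w h * T p h)" and ?k = "\<lambda>h. w h * of_bool (h \<in> D)"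
  have "(\<Sum>\<^sub>\<infinity>h\<in>H. w h * (T p h * T q h)) \<le> (\<Sum>\<^sub>\<infinity>h\<in>H. (?f h + ?g h) + ?k h)"
  proof (rule infsum_mono)
    show "(\<lambda>h. w h * (T p h * T q h)) summable_on H"
      by (rule summable_w_bounded[of _ 1]) (simp_all add: T_nonneg T_le_1 mult_le_one)
    show "(\<lambda>h. (?f h + ?g h) + ?k h) summable_on H" by (intro summable_on_add s1 s2)
    fix h assume "h \<in> H"
    from mult_left_mono[OF TT[OF this] w_nonneg[of h]]
    show "w h * (T p h * T q h) \<le> (?f h + ?g h) + ?k h" by (simp add: algebra_simps)
  qed
  also have "\<dots> = (\<Sum>\<^sub>\<infinity>h\<in>H. ?f h) + (\<Sum>\<^sub>\<infinity>h\<in>H. ?g h) + (\<Sum>\<^sub>\<infinity>h\<in>H. ?k h)"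
    by (simp only: infsum_add[OF summable_on_add[OF s1 s1] s2] infsum_add[OF s1 s1])
  also have "(\<Sum>\<^sub>\<infinity>h\<in>H. ?f h) = 2 / real p * (\<Sum>\<^sub>\<infinity>h\<in>H. w h * T q h)" by (rule infsum_cmult_right')
  also have "(\<Sum>\<^sub>\<infinity>h\<in>H. ?g h) = 2 / real q * (\<Sum>\<^sub>\<infinity>h\<in>H. w h * T p h)" by (rule infsum_cmult_right')
  also have "(\<Sum>\<^sub>\<infinity>h\<in>H. ?k h) = (\<Sum>\<^sub>\<infinity>h\<in>D. w h)" by (rule infsum_cong_neutral) (auto simp: D_def)
  also have "2 / real p * (\<Sum>\<^sub>\<infinity>h\<in>H. w h * T q h) \<le> 2 / real p * (4 * \<mu> lam / real q) powr (2 * lam)"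
    using assms by (intro mult_left_mono infsum_w_T_le) auto
  also have "2 / real q * (\<Sum>\<^sub>\<infinity>h\<in>H. w h * T p h) \<le> 2 / real q * (4 * \<mu> lam / real p) powr (2 * lam)"
    using assms by (intro mult_left_mono infsum_w_T_le) auto
  also have "(\<Sum>\<^sub>\<infinity>h\<in>D. w h) \<le> (\<mu> lam / real (p * q)) powr (2 * lam)"
    unfolding D_def using assms \<open>p > 0\<close> \<open>q > 0\<close> by (intro infsum_w_multiples_le) auto
  finally show ?thesis by simp
qed

section \<open>Second moment of the number of primes hitting a frequency\<close>

text \<open>This is \<open>card P\<close> times the proportion \<omega> of the overview, with a
  separate vector \<open>F p\<close> for each prime. Division by \<open>card P\<close> is postponed
  to \<open>ran_error_le\<close>.\<close>

definition hits :: "nat set \<Rightarrow> (nat \<Rightarrow> nat \<Rightarrow> int) \<Rightarrow> (nat \<Rightarrow> int) \<Rightarrow> real" where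
  "hits P F h = (\<Sum>p\<in>P. of_bool (int p dvd dotp d h (F p)))"

lemma hits_nonneg: "hits P F h \<ge> 0" and hits_le: "hits P F h \<le> real (card P)"
proof -
  show "hits P F h \<ge> 0" unfolding hits_def by (intro sum_nonneg) auto
  show "hits P F h \<le> real (card P)"
    unfolding hits_def using sum_bounded_above[of P "\<lambda>p. of_bool (int p dvd dotp d h (F p))" "1::real"] by simp
qed

definition E :: "nat set \<Rightarrow> (nat \<Rightarrow> nat \<Rightarrow> int) \<Rightarrow> real" where
  "E P F = (\<Sum>\<^sub>\<infinity>h\<in>H. w h * (hits P F h)\<^sup>2)"

lemma E_nonneg: "E P F \<ge> 0"
  unfolding E_def by (intro infsum_nonneg) simp

lemma summable_E: "(\<lambda>h. w h * (hits P F h)\<^sup>2) summable_on H"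
  by (rule summable_w_bounded[of _ "(real (card P))\<^sup>2"]) (auto intro: power_mono hits_le hits_nonneg)

text \<open>Expanding the square gives pairs of divisibility events, which are independent for p
  \<noteq> q. Indexing the product by the set \<open>{p, q}\<close> makes the diagonal collapse to
  the single factor \<open>T p h\<close>, where the gain of 1/n is lost.\<close>

lemma sum_E:
  assumes "finite P" "\<And>p. p \<in> P \<Longrightarrow> prime p"
  shows "(\<Sum>F\<in>Pi\<^sub>E P good. E P F)
    = real (card (Pi\<^sub>E P good)) * (\<Sum>p\<in>P. \<Sum>q\<in>P. \<Sum>\<^sub>\<infinity>h\<in>H. w h * (\<Prod>r\<in>{p, q}. T r h))"
proof -
  let ?N = "real (card (Pi\<^sub>E P good))"
  have fin: "finite (Pi\<^sub>E P good)" using assms(1) by (intro finite_PiE) auto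
  have sq: "(\<Sum>F\<in>Pi\<^sub>E P good. (hits P F h)\<^sup>2) = ?N * (\<Sum>p\<in>P. \<Sum>q\<in>P. \<Prod>r\<in>{p, q}. T r h)" for h
  proof -
    have "(\<Sum>F\<in>Pi\<^sub>E P good. (hits P F h)\<^sup>2)
        = (\<Sum>F\<in>Pi\<^sub>E P good. \<Sum>p\<in>P. \<Sum>q\<in>P. of_bool (\<forall>r\<in>{p, q}. int r dvd dotp d h (F r)))"
      by (simp add: hits_def power2_eq_square sum_product of_bool_conj)
    also have "\<dots> = (\<Sum>p\<in>P. \<Sum>q\<in>P. \<Sum>F\<in>Pi\<^sub>E P good. of_bool (\<forall>r\<in>{p, q}. int r dvd dotp d h (F r)))"
      by (subst sum.swap, rule sum.cong[OF refl], rule sum.swap)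
    also have "\<dots> = (\<Sum>p\<in>P. \<Sum>q\<in>P. ?N * (\<Prod>r\<in>{p, q}. T r h))"
    proof (intro sum.cong refl)
      fix p q assume "p \<in> P" "q \<in> P"
      have "(\<Sum>F\<in>Pi\<^sub>E P good. of_bool (\<forall>r\<in>{p, q}. int r dvd dotp d h (F r)))
          = real (card {F \<in> Pi\<^sub>E P good. \<forall>r\<in>{p, q}. int r dvd dotp d h (F r)})"
        using fin by (subst sum_of_bool_eq) (auto simp: Int_def)
      also have "\<dots> = ?N * (\<Prod>r\<in>{p, q}. T r h)"
        unfolding T_def using assms \<open>p \<in> P\<close> \<open>q \<in> P\<close> good_nonempty
        by (intro card_PiE_constrained[where C = "\<lambda>r z. int r dvd dotp d h z"]) auto
      finally show "(\<Sum>F\<in>Pi\<^sub>E P good. of_bool (\<forall>r\<in>{p, q}. int r dvd dotp d h (F r))) = ?N * (\<Prod>r\<in>{p, q}. T r h)" .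
    qed
    finally show ?thesis by (simp add: sum_distrib_left)
  qed
  have s: "(\<lambda>h. w h * (\<Prod>r\<in>{p, q}. T r h)) summable_on H" for p q
    by (rule summable_w_bounded[of _ 1]) (auto intro!: prod_nonneg prod_le_1 T_nonneg T_le_1)
  have "(\<Sum>F\<in>Pi\<^sub>E P good. E P F) = (\<Sum>\<^sub>\<infinity>h\<in>H. w h * (\<Sum>F\<in>Pi\<^sub>E P good. (hits P F h)\<^sup>2))"
    unfolding E_def sum_distrib_left by (rule infsum_sum_swap) (rule summable_E)
  also have "\<dots> = (\<Sum>\<^sub>\<infinity>h\<in>H. ?N * (\<Sum>p\<in>P. \<Sum>q\<in>P. w h * (\<Prod>r\<in>{p, q}. T r h)))"
    unfolding sq by (simp add: sum_distrib_left mult_ac)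
  also have "\<dots> = ?N * (\<Sum>\<^sub>\<infinity>h\<in>H. \<Sum>p\<in>P. \<Sum>q\<in>P. w h * (\<Prod>r\<in>{p, q}. T r h))"
    by (rule infsum_cmult_right')
  also have "(\<Sum>\<^sub>\<infinity>h\<in>H. \<Sum>p\<in>P. \<Sum>q\<in>P. w h * (\<Prod>r\<in>{p, q}. T r h))
      = (\<Sum>p\<in>P. \<Sum>\<^sub>\<infinity>h\<in>H. \<Sum>q\<in>P. w h * (\<Prod>r\<in>{p, q}. T r h))"
    by (intro infsum_sum_swap[symmetric] summable_on_sum s)
  also have "\<dots> = (\<Sum>p\<in>P. \<Sum>q\<in>P. \<Sum>\<^sub>\<infinity>h\<in>H. w h * (\<Prod>r\<in>{p, q}. T r h))"
    by (intro sum.cong refl infsum_sum_swap[symmetric] s)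
  finally show ?thesis .
qed

text \<open>Since p > n/2, 4 \<mu> / p becomes 8 \<mu> / n and 2/p becomes 4/n. The 9 is 4 + 4 + 1:
  two mixed terms, and the common multiples of \<open>p\<close> and \<open>q\<close>, for which n
  powr (- 2 lam) \<le> 1/n is used.\<close>

lemma infsum_w_prod_T_le:
  assumes "p \<in> primes_half n" "q \<in> primes_half n" "n \<ge> 2" "1/2 \<le> lam" "lam < \<alpha>"
  defines "\<beta> \<equiv> (8 * \<mu> lam / real n) powr (2 * lam)"
  shows "(\<Sum>\<^sub>\<infinity>h\<in>H. w h * (\<Prod>r\<in>{p, q}. T r h)) \<le> (if p = q then \<beta> else 9 * \<beta> / real n)"
proof -
  have p: "prime p" "real n \<le> 2 * real p" "real p > 0" and q: "prime q" "real n \<le> 2 * real q" "real q > 0"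
    using assms(1-3) by (auto simp: primes_half_def prime_gt_0_nat)
  have \<mu>: "\<mu> lam \<ge> 0" by (rule korobov_mu_nonneg)
  have b: "(4 * \<mu> lam / real r) powr (2 * lam) \<le> \<beta>" if "real n \<le> 2 * real r" "real r > 0" for r
  proof -
    have "4 * \<mu> lam * real n \<le> 4 * \<mu> lam * (2 * real r)" using that \<mu> by (intro mult_left_mono) auto
    then have "4 * \<mu> lam / real r \<le> 8 * \<mu> lam / real n"
      using that assms(3) by (simp add: field_simps)
    then show ?thesis unfolding \<beta>_def using \<mu> that assms(4) by (intro powr_mono2) auto
  qed
  have \<beta>: "\<beta> \<ge> 0" by (simp add: \<beta>_def)
  have inv: "2 / real r \<le> 4 / real n" if "real n \<le> 2 * real r" "real r > 0" for r
    using that assms(3) by (simp add: field_simps)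
  show ?thesis
  proof (cases "p = q")
    case True
    then show ?thesis using infsum_w_T_le[OF p(1) assms(4,5)] b[OF p(2,3)] by simp
  next
    case False
    have "(\<mu> lam / (real p * real q)) powr (2 * lam) \<le> ((8 * \<mu> lam / real n) / real n) powr (2 * lam)"
    proof (rule powr_mono2)
      have "real n * real n \<le> (2 * real p) * (2 * real q)" using p q by (intro mult_mono) auto
      moreover have "0 \<le> real p * real q" by simp
      ultimately have "real n * real n \<le> 8 * (real p * real q)" by linarith
      then have "\<mu> lam * (real n * real n) \<le> \<mu> lam * (8 * (real p * real q))"
        using \<mu> p(3) q(3) by (intro mult_left_mono) auto
      then show "\<mu> lam / (real p * real q) \<le> 8 * \<mu> lam / real n / real n"
        using p(3) q(3) assms(3) by (simp add: divide_le_eq le_divide_eq mult_ac)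
    qed (use \<mu> p q assms(4) in auto)
    also have "\<dots> = (8 * \<mu> lam / real n) powr (2 * lam) / real n powr (2 * lam)"
      by (rule powr_divide)
    also have "\<dots> = \<beta> * real n powr (- (2 * lam))"
      by (simp add: \<beta>_def powr_minus_divide)
    also have "\<dots> \<le> \<beta> * real n powr (- 1)"
      using assms(3,4) \<beta> by (intro mult_left_mono powr_mono) auto
    also have "\<dots> = \<beta> / real n" using assms(3) by (simp add: powr_minus_divide)
    finally have 3: "(\<mu> lam / (real p * real q)) powr (2 * lam) \<le> \<beta> / real n" .
    have 1: "2 / real p * (4 * \<mu> lam / real q) powr (2 * lam) \<le> 4 / real n * \<beta>"
      using inv[OF p(2,3)] b[OF q(2,3)] by (intro mult_mono) auto
    have 2: "2 / real q * (4 * \<mu> lam / real p) powr (2 * lam) \<le> 4 / real n * \<beta>"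
      using inv[OF q(2,3)] b[OF p(2,3)] by (intro mult_mono) auto
    have "(\<Sum>\<^sub>\<infinity>h\<in>H. w h * (\<Prod>r\<in>{p, q}. T r h)) = (\<Sum>\<^sub>\<infinity>h\<in>H. w h * (T p h * T q h))"
      using False by simp
    also have "\<dots> \<le> 4 / real n * \<beta> + 4 / real n * \<beta> + \<beta> / real n"
      using infsum_w_T_T_le[OF p(1) q(1) False assms(4,5)] 1 2 3 by linarith
    also have "\<dots> = 9 * \<beta> / real n" by (simp add: field_simps)
    finally show ?thesis using False by simp
  qed
qed

lemma exists_E_le:
  assumes "n \<ge> 2"
  defines "P \<equiv> primes_half n"
  obtains F where "F \<in> Pi\<^sub>E P (residue_vecs d)"
    "\<And>lam. 1/2 \<le> lam \<Longrightarrow> lam < \<alpha> \<Longrightarrow>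
       E P F \<le> (real (card P) + 9 * (real (card P))\<^sup>2 / real n) * (8 * \<mu> lam / real n) powr (2 * lam)"
proof -
  have fin: "finite P" by (simp add: P_def)
  have primes: "prime p" if "p \<in> P" for p using that by (simp add: P_def primes_half_def)
  have finG: "finite (Pi\<^sub>E P good)" using fin by (intro finite_PiE) auto
  have neG: "Pi\<^sub>E P good \<noteq> {}" using good_nonempty primes by (auto simp: PiE_eq_empty_iff)
  obtain F where F: "F \<in> Pi\<^sub>E P good" "\<And>F'. F' \<in> Pi\<^sub>E P good \<Longrightarrow> E P F \<le> E P F'"
    using ex_is_arg_min_if_finite[OF finG neG, of "E P"] by (auto simp: is_arg_min_linorder)
  show ?thesis
  proof (rule that)
    show "F \<in> Pi\<^sub>E P (residue_vecs d)" using F(1) by (auto simp: PiE_iff good_def)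
    fix lam assume lam: "1/2 \<le> lam" "lam < \<alpha>"
    define \<beta> where "\<beta> = (8 * \<mu> lam / real n) powr (2 * lam)"
    have "\<beta> \<ge> 0" by (simp add: \<beta>_def)
    have "real (card (Pi\<^sub>E P good)) * E P F \<le> (\<Sum>F'\<in>Pi\<^sub>E P good. E P F')"
      using F(2) by (intro sum_bounded_below) auto
    also have "\<dots> = real (card (Pi\<^sub>E P good)) * (\<Sum>p\<in>P. \<Sum>q\<in>P. \<Sum>\<^sub>\<infinity>h\<in>H. w h * (\<Prod>r\<in>{p, q}. T r h))"
      by (rule sum_E[OF fin primes])
    finally have "E P F \<le> (\<Sum>p\<in>P. \<Sum>q\<in>P. \<Sum>\<^sub>\<infinity>h\<in>H. w h * (\<Prod>r\<in>{p, q}. T r h))"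
      by (rule mult_left_le_imp_le) (use finG neG in \<open>simp add: card_gt_0_iff\<close>)
    \<comment> \<open>Granting the off-diagonal amount to the diagonal too lets the double sum be
      evaluated without separating the cases.\<close>
    also have "\<dots> \<le> (\<Sum>p\<in>P. \<Sum>q\<in>P. (if p = q then \<beta> else 0) + 9 * \<beta> / real n)"
    proof (intro sum_mono)
      fix p q assume "p \<in> P" "q \<in> P"
      then have "(\<Sum>\<^sub>\<infinity>h\<in>H. w h * (\<Prod>r\<in>{p, q}. T r h)) \<le> (if p = q then \<beta> else 9 * \<beta> / real n)"
        unfolding \<beta>_def P_def using assms(1) lam by (intro infsum_w_prod_T_le)
      also have "\<dots> \<le> (if p = q then \<beta> else 0) + 9 * \<beta> / real n" using \<open>\<beta> \<ge> 0\<close> by simp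
      finally show "(\<Sum>\<^sub>\<infinity>h\<in>H. w h * (\<Prod>r\<in>{p, q}. T r h)) \<le> (if p = q then \<beta> else 0) + 9 * \<beta> / real n" .
    qed
    also have "\<dots> = (real (card P) + 9 * (real (card P))\<^sup>2 / real n) * \<beta>"
      using fin by (simp add: sum.distrib algebra_simps power2_eq_square)
    finally show "E P F \<le> (real (card P) + 9 * (real (card P))\<^sup>2 / real n) * (8 * \<mu> lam / real n) powr (2 * lam)"
      by (simp add: \<beta>_def)
  qed
qed

end

section \<open>One integer vector and its randomised error\<close>

text \<open>The Chinese remainder theorem in each coordinate. \<open>dual_lattice d p z\<close>
  depends only on \<open>z\<close> modulo \<open>p\<close>, so congruent vectors are
  interchangeable.\<close>

lemma exists_common_residues:
  assumes "finite P" "\<And>p. p \<in> P \<Longrightarrow> prime p" "F \<in> Pi\<^sub>E P (residue_vecs d)"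
  shows "\<exists>z\<in>{1..d} \<rightarrow>\<^sub>E {0..<int (\<Prod>p\<in>P. p)}. \<forall>p\<in>P. dual_lattice d p z = dual_lattice d p (F p)"
proof -
  have "\<exists>x. x < (\<Prod>p\<in>P. p) \<and> (\<forall>p\<in>P. [x = nat (F p j)] (mod p))" for j
    using assms(1,2) chinese_remainder_unique_nat[of P "\<lambda>p. p" "\<lambda>p. nat (F p j)"]
    by (auto simp: primes_coprime dest: prime_gt_0_nat)
  then obtain X where X: "\<And>j. X j < (\<Prod>p\<in>P. p)" "\<And>j p. p \<in> P \<Longrightarrow> [X j = nat (F p j)] (mod p)"
    by metis
  define z where "z = (\<lambda>j\<in>{1..d}. int (X j))"
  have "dual_lattice d p z = dual_lattice d p (F p)" if p: "p \<in> P" for p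
  proof -
    have "int p dvd z j - F p j" if j: "j \<in> {1..d}" for j
    proof -
      have "F p j \<ge> 0" using assms(3) p j by (auto simp: residue_vecs_def PiE_iff)
      then have "[z j = F p j] (mod int p)"
        using X(2)[OF p, of j] j by (simp add: z_def flip: cong_int_iff)
      then show ?thesis by (simp add: cong_iff_dvd_diff)
    qed
    then have "int p dvd (\<Sum>j\<in>{1..d}. h j * (z j - F p j))" for h
      by (intro dvd_sum dvd_mult) auto
    then have "int p dvd dotp d h z - dotp d h (F p)" for h
      by (simp add: dotp_def right_diff_distrib sum_subtractf)
    then have "int p dvd dotp d h z \<longleftrightarrow> int p dvd dotp d h (F p)" for h
      by (metis dvd_diff_right_iff dvd_diff_left_iff)
    then show ?thesis by (simp add: dual_lattice_def)
  qed
  moreover have "z \<in> {1..d} \<rightarrow>\<^sub>E {0..<int (\<Prod>p\<in>P. p)}"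
    using X(1) by (auto simp: z_def simp del: of_nat_prod)
  ultimately show ?thesis by blast
qed

text \<open>The expectation is a finite mean. Nonemptiness matters because \<open>pmf_of_set\<close>
  has its intended meaning only on nonempty finite sets.\<close>

lemma ran_error_eq:
  assumes "primes_half n \<noteq> {}"
  shows "(\<integral>\<^sup>+ y. ennreal (cmod (y - c)) \<partial>measure_pmf (ran_lattice_rule d n z f))
    = ennreal ((\<Sum>p\<in>primes_half n. cmod (lattice_rule d p z f - c)) / real (card (primes_half n)))"
proof -
  have "card (primes_half n) > 0" using assms by (simp add: card_gt_0_iff)
  then show ?thesis
    unfolding ran_lattice_rule_def nn_integral_map_pmf
    using assms by (simp add: nn_integral_pmf_of_set sum_nonneg divide_ennreal ennreal_of_nat_eq_real_of_nat)
qed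

context korobov
begin

text \<open>Cauchy-Schwarz in the form of a weighted arithmetic-geometric mean inequality with a
  free parameter \<open>t\<close>. At \<open>t = 1\<close> it yields summability by comparison; at
  \<open>t = sqrt (E P F)\<close> it yields the bound.\<close>

lemma weighted_sum_le_sqrt_E:
  assumes f: "f \<in> korobov_space d \<alpha> \<gamma>" "korobov_norm d \<alpha> \<gamma> f \<le> 1"
  shows "(\<lambda>h. cmod (fourier_coeff d f h)) summable_on int_vecs d"
    and "(\<Sum>\<^sub>\<infinity>h\<in>H. cmod (fourier_coeff d f h) * hits P F h) \<le> sqrt (E P F)"
proof -
  define c where "c h = cmod (fourier_coeff d f h)" for h
  define y where "y h = (korobov_r d \<alpha> \<gamma> h)\<^sup>2 * (c h)\<^sup>2" for h
  have y: "y summable_on int_vecs d" using f(1) by (simp add: korobov_space_def y_def[abs_def] c_def)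
  then have yH: "y summable_on H" by (rule summable_on_subset) auto
  have "(\<Sum>\<^sub>\<infinity>h\<in>int_vecs d. y h) \<le> 1"
    using f(2) by (simp add: korobov_norm_def y_def c_def real_sqrt_le_1_iff)
  moreover have "(\<Sum>\<^sub>\<infinity>h\<in>H. y h) \<le> (\<Sum>\<^sub>\<infinity>h\<in>int_vecs d. y h)"
    by (rule infsum_mono2[OF yH y]) (auto simp: y_def)
  ultimately have y1: "(\<Sum>\<^sub>\<infinity>h\<in>H. y h) \<le> 1" by simp
  have amgm: "c h * g \<le> t / 2 * y h + 1 / (2 * t) * (w h * g\<^sup>2)" if "t > 0" for h g t
  proof -
    define r where "r = korobov_r d \<alpha> \<gamma> h"
    have "r > 0" unfolding r_def by (rule r_pos)
    have w: "w h = 1 / r\<^sup>2" using \<open>r > 0\<close> by (simp add: w_def r_def powr_minus_divide)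
    have "0 \<le> (t * r * c h - g / r)\<^sup>2 / (2 * t)" using that by simp
    also have "\<dots> = t / 2 * (r\<^sup>2 * (c h)\<^sup>2) + 1 / (2 * t) * (1 / r\<^sup>2 * g\<^sup>2) - c h * g"
      using that \<open>r > 0\<close> by (simp add: power2_eq_square field_simps)
    finally show ?thesis by (simp add: y_def w r_def)
  qed
  have cH: "(\<lambda>h. c h * g h) summable_on H" if "\<And>h. 0 \<le> g h" "\<And>h. g h \<le> B" for g B
  proof (rule summable_on_comparison_test)
    show "(\<lambda>h. 1 / 2 * y h + 1 / (2 * 1) * (w h * (g h)\<^sup>2)) summable_on H"
      using that by (intro summable_on_add summable_on_cmult_right yH summable_w_bounded[of _ "B\<^sup>2"] power_mono) auto
    show "c h * g h \<le> 1 / 2 * y h + 1 / (2 * 1) * (w h * (g h)\<^sup>2)" for h by (rule amgm) simp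
    show "0 \<le> c h * g h" for h using that by (simp add: c_def)
  qed
  have eq: "insert (zero_vec d) H = int_vecs d" by (auto simp: int_vecs_def zero_vec_def)
  have "c summable_on H" using cH[of "\<lambda>_. 1" 1] by simp
  then have "c summable_on insert (zero_vec d) H" by (subst summable_on_insert_iff)
  then show "(\<lambda>h. cmod (fourier_coeff d f h)) summable_on int_vecs d"
    by (simp only: eq c_def[abs_def])
  have main: "(\<Sum>\<^sub>\<infinity>h\<in>H. c h * hits P F h) \<le> t / 2 + E P F / (2 * t)" if "t > 0" for t
  proof -
    have s: "(\<lambda>h. t / 2 * y h) summable_on H" "(\<lambda>h. 1 / (2 * t) * (w h * (hits P F h)\<^sup>2)) summable_on H"
      by (intro summable_on_cmult_right yH summable_E)+
    have "(\<Sum>\<^sub>\<infinity>h\<in>H. c h * hits P F h) \<le> (\<Sum>\<^sub>\<infinity>h\<in>H. t / 2 * y h + 1 / (2 * t) * (w h * (hits P F h)\<^sup>2))"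
      by (intro infsum_mono cH[of _ "real (card P)"] hits_nonneg hits_le summable_on_add s amgm that)
    also have "\<dots> = t / 2 * (\<Sum>\<^sub>\<infinity>h\<in>H. y h) + 1 / (2 * t) * E P F"
      unfolding E_def by (simp only: infsum_add[OF s] infsum_cmult_right')
    also have "\<dots> \<le> t / 2 * 1 + 1 / (2 * t) * E P F"
      using y1 that by (intro add_right_mono mult_left_mono) auto
    finally show ?thesis by simp
  qed
  have "(\<Sum>\<^sub>\<infinity>h\<in>H. c h * hits P F h) \<le> sqrt (E P F)"
  \<comment> \<open>If \<open>E P F\<close> vanishes, the optimal parameter would be 0, which is not
    allowed; then \<open>t\<close> tends to 0 instead.\<close>
  proof (cases "E P F = 0")
    case True
    have "(\<Sum>\<^sub>\<infinity>h\<in>H. c h * hits P F h) \<le> 0 + e" if "e > 0" for e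
      using main[of "2 * e"] that True by simp
    then have "(\<Sum>\<^sub>\<infinity>h\<in>H. c h * hits P F h) \<le> 0" by (rule field_le_epsilon)
    then show ?thesis using True by simp
  next
    case False
    then have "E P F > 0" using E_nonneg[of P F] by simp
    then have "sqrt (E P F) / 2 + E P F / (2 * sqrt (E P F)) = sqrt (E P F)"
      by (simp add: real_div_sqrt field_simps)
    then show ?thesis using main[of "sqrt (E P F)"] \<open>E P F > 0\<close> by simp
  qed
  then show "(\<Sum>\<^sub>\<infinity>h\<in>H. cmod (fourier_coeff d f h) * hits P F h) \<le> sqrt (E P F)" by (simp add: c_def)
qed

text \<open>Summing the dual-lattice bounds over all primes before estimating merges them into one
  series in which each coefficient is counted \<open>hits P F h\<close> times. Cauchy-Schwarz is
  applied only once, to that series.\<close>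

lemma ran_error_le:
  fixes n :: nat
  defines "P \<equiv> primes_half n"
  assumes "P \<noteq> {}" "\<And>p. p \<in> P \<Longrightarrow> dual_lattice d p z = dual_lattice d p (F p)"
  shows "ran_error d \<alpha> \<gamma> (ran_lattice_rule d n z) \<le> ennreal (sqrt (E P F) / real (card P))"
  unfolding ran_error_def
proof (rule SUP_least)
  fix f assume "f \<in> {f \<in> korobov_space d \<alpha> \<gamma>. korobov_norm d \<alpha> \<gamma> f \<le> 1}"
  then have f: "f \<in> korobov_space d \<alpha> \<gamma>" "korobov_norm d \<alpha> \<gamma> f \<le> 1" by auto
  define c where "c h = cmod (fourier_coeff d f h)" for h
  have c: "c summable_on int_vecs d" using weighted_sum_le_sqrt_E(1)[OF f] by (simp add: c_def[abs_def])
  have "cmod (lattice_rule d p z f - integral_cube d f) \<le> (\<Sum>\<^sub>\<infinity>h\<in>H. c h * of_bool (int p dvd dotp d h (F p)))"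
    if "p \<in> P" for p
  proof -
    have "p > 0" using that by (simp add: P_def primes_half_def prime_gt_0_nat)
    then have "cmod (lattice_rule d p z f - integral_cube d f) \<le> (\<Sum>\<^sub>\<infinity>h\<in>dual_lattice d p z. c h)"
      unfolding c_def using f(1) c by (intro lattice_rule_error) (auto simp: korobov_space_def c_def[abs_def])
    then show ?thesis using assms(3)[OF that] by (simp add: infsum_dual_eq)
  qed
  then have "(\<Sum>p\<in>P. cmod (lattice_rule d p z f - integral_cube d f))
      \<le> (\<Sum>p\<in>P. \<Sum>\<^sub>\<infinity>h\<in>H. c h * of_bool (int p dvd dotp d h (F p)))"
    by (rule sum_mono)
  also have "\<dots> = (\<Sum>\<^sub>\<infinity>h\<in>H. \<Sum>p\<in>P. c h * of_bool (int p dvd dotp d h (F p)))"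
  proof (rule infsum_sum_swap)
    have "c summable_on H" using c by (rule summable_on_subset) auto
    then show "(\<lambda>h. c h * of_bool (int p dvd dotp d h (F p))) summable_on H" for p
      by (rule summable_on_comparison_test) (auto simp: c_def)
  qed
  also have "\<dots> = (\<Sum>\<^sub>\<infinity>h\<in>H. c h * hits P F h)"
    by (simp add: hits_def sum_distrib_left)
  also have "\<dots> \<le> sqrt (E P F)"
    unfolding c_def by (rule weighted_sum_le_sqrt_E(2)[OF f])
  finally have "(\<Sum>p\<in>P. cmod (lattice_rule d p z f - integral_cube d f)) / real (card P) \<le> sqrt (E P F) / real (card P)"
    by (rule divide_right_mono) simp
  then show "(\<integral>\<^sup>+ y. ennreal (cmod (y - integral_cube d f)) \<partial>measure_pmf (ran_lattice_rule d n z f))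
      \<le> ennreal (sqrt (E P F) / real (card P))"
    using assms(2) unfolding P_def by (subst ran_error_eq) (auto intro: ennreal_leI)
qed

text \<open>\<open>L\<close> stands for \<open>card P\<close>. After dividing by L^2, the diagonal
  costs 1/L \<le> 30000 ln n / n, and the off-diagonal 9/n is below 10000 ln n / n because ln n
  \<ge> 2/3; together this is 40000. The factor 8 powr (2 lam) is inherited from 8 \<mu> /
  n.\<close>

lemma sqrt_E_le_error_bound:
  assumes "n \<ge> 2" "1/2 \<le> lam" "lam < \<alpha>"
    and L: "L > 0" "real n \<le> 30000 * ln (real n) * L"
    and e: "e \<le> (L + 9 * L\<^sup>2 / real n) * (8 * \<mu> lam / real n) powr (2 * lam)"
  shows "sqrt e / L \<le> error_bound (40000 * 8 powr (2 * lam)) d \<alpha> \<gamma> n lam"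
proof -
  define \<beta> where "\<beta> = (8 * \<mu> lam / real n) powr (2 * lam)"
  have "\<beta> \<ge> 0" by (simp add: \<beta>_def)
  have \<mu>: "\<mu> lam \<ge> 0" by (rule korobov_mu_nonneg)
  have n: "real n > 0" "real n \<ge> 2" using assms(1) by auto
  have ln: "ln (real n) \<ge> 2 / 3"
    using ln2_ge_two_thirds n ln_le_cancel_iff[of 2 "real n"] by linarith
  have "1 / L + 9 / real n \<le> 40000 * ln (real n) / real n"
  proof -
    define u where "u = ln (real n) / real n"
    have "1 / L \<le> 30000 * u" using L n by (simp add: u_def field_simps)
    moreover have "9 / real n \<le> 10000 * u"
      using n ln divide_right_mono[of 9 "10000 * ln (real n)" "real n"] by (simp add: u_def)
    ultimately have "1 / L + 9 / real n \<le> 40000 * u" by linarith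
    then show ?thesis by (simp add: u_def)
  qed
  then have "(1 / L + 9 / real n) * \<beta> \<le> 40000 * ln (real n) / real n * \<beta>"
    using \<open>\<beta> \<ge> 0\<close> by (rule mult_right_mono)
  moreover have "e / L\<^sup>2 \<le> (1 / L + 9 / real n) * \<beta>"
    using e L(1) n unfolding \<beta>_def[symmetric] by (simp add: field_simps power2_eq_square)
  ultimately have 1: "e / L\<^sup>2 \<le> 40000 * ln (real n) / real n * \<beta>" by simp
  have sq: "(x powr b)\<^sup>2 = x powr (2 * b)" for x b :: real
    by (simp add: power2_eq_square flip: powr_add)
  have "(error_bound (40000 * 8 powr (2 * lam)) d \<alpha> \<gamma> n lam)\<^sup>2
      = 40000 * 8 powr (2 * lam) * ln (real n) / real n powr (2 * lam + 1) * \<mu> lam powr (2 * lam)"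
    using ln by (simp add: error_bound_def power_mult_distrib power_divide sq)
  also have "\<dots> = 40000 * ln (real n) / real n * \<beta>"
    unfolding \<beta>_def using n \<mu> by (simp add: powr_divide powr_mult powr_add mult_ac)
  finally have "e / L\<^sup>2 \<le> (error_bound (40000 * 8 powr (2 * lam)) d \<alpha> \<gamma> n lam)\<^sup>2" using 1 by simp
  then have "sqrt (e / L\<^sup>2) \<le> sqrt ((error_bound (40000 * 8 powr (2 * lam)) d \<alpha> \<gamma> n lam)\<^sup>2)"
    by (rule real_sqrt_le_mono)
  moreover have "error_bound (40000 * 8 powr (2 * lam)) d \<alpha> \<gamma> n lam \<ge> 0"
    unfolding error_bound_def using ln by (intro mult_nonneg_nonneg divide_nonneg_nonneg) auto
  ultimately show ?thesis using L(1) by (simp add: real_sqrt_divide)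
qed

lemma exists_generating_vector:
  assumes "n \<ge> 2"
  shows "\<exists>z\<in>{1..d} \<rightarrow>\<^sub>E {0..<int (\<Prod>p\<in>primes_half n. p)}. \<forall>lam\<in>{1/2..<\<alpha>}.
    ran_error d \<alpha> \<gamma> (ran_lattice_rule d n z) \<le> ennreal (error_bound (40000 * 8 powr (2 * lam)) d \<alpha> \<gamma> n lam)"
proof -
  define P where "P = primes_half n"
  obtain F where F: "F \<in> Pi\<^sub>E P (residue_vecs d)"
    "\<And>lam. 1/2 \<le> lam \<Longrightarrow> lam < \<alpha> \<Longrightarrow>
       E P F \<le> (real (card P) + 9 * (real (card P))\<^sup>2 / real n) * (8 * \<mu> lam / real n) powr (2 * lam)"
    unfolding P_def using exists_E_le[OF assms] by blast
  have "finite P" "\<And>p. p \<in> P \<Longrightarrow> prime p" by (simp_all add: P_def) (simp add: primes_half_def)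
  from exists_common_residues[OF this F(1)]
  obtain z where z: "z \<in> {1..d} \<rightarrow>\<^sub>E {0..<int (\<Prod>p\<in>P. p)}"
    "\<And>p. p \<in> P \<Longrightarrow> dual_lattice d p z = dual_lattice d p (F p)"
    by blast
  have L: "real n \<le> 30000 * ln (real n) * real (card P)"
    unfolding P_def by (rule card_primes_half_ge[OF assms])
  \<comment> \<open>The prime count bound contains Bertrand's postulate: an empty \<open>P\<close>
    would give \<open>n \<le> 0\<close>.\<close>
  then have "card P > 0" using assms by (intro gr0I) auto
  then have "P \<noteq> {}" by auto
  have "ran_error d \<alpha> \<gamma> (ran_lattice_rule d n z) \<le> ennreal (error_bound (40000 * 8 powr (2 * lam)) d \<alpha> \<gamma> n lam)"
    if lam: "lam \<in> {1/2..<\<alpha>}" for lam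
  proof -
    have "ran_error d \<alpha> \<gamma> (ran_lattice_rule d n z) \<le> ennreal (sqrt (E P F) / real (card P))"
      using \<open>P \<noteq> {}\<close> z(2) unfolding P_def by (rule ran_error_le)
    also have "sqrt (E P F) / real (card P) \<le> error_bound (40000 * 8 powr (2 * lam)) d \<alpha> \<gamma> n lam"
      using assms lam L \<open>card P > 0\<close> F(2)[of lam] by (intro sqrt_E_le_error_bound) auto
    finally show ?thesis by (simp add: ennreal_leI)
  qed
  then show ?thesis using z(1) unfolding P_def by blast
qed

end

theorem theorem3p2:
  shows "\<exists>C :: real \<Rightarrow> real. (\<forall>lam\<ge>1/2. C lam > 0) \<and>
    (\<forall>(\<alpha>::real) (\<gamma> :: nat set \<Rightarrow> real). \<alpha> > 1/2 \<longrightarrow> positive_weights \<gamma> \<longrightarrow>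
      (\<forall>d\<ge>1. \<forall>n\<ge>2. \<exists>z \<in> {1..d} \<rightarrow>\<^sub>E {0..<int (\<Prod>p\<in>primes_half n. p)}.
         \<forall>lam\<in>{1/2..<\<alpha>}.
           ran_error d \<alpha> \<gamma> (ran_lattice_rule d n z) \<le> ennreal (error_bound (C lam) d \<alpha> \<gamma> n lam)) \<and>
      (\<forall>d\<ge>1. filterlim (\<lambda>lam. korobov_mu d \<alpha> \<gamma> lam) at_top (at_left \<alpha>)) \<and>
      (\<forall>lam\<in>{1/2..<\<alpha>}.
         (\<lambda>u. \<gamma> u powr (1/lam) * (2 * real_zeta (\<alpha>/lam)) ^ card u)
            summable_on {u. finite u \<and> u \<noteq> {} \<and> u \<subseteq> {1..}} \<longrightarrow>
         (\<forall>n\<ge>2. \<exists>B. \<forall>d\<ge>1. error_bound (C lam) d \<alpha> \<gamma> n lam \<le> B)))"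
proof (rule exI[of _ "\<lambda>lam. 40000 * 8 powr (2 * lam)"], intro conjI allI impI ballI)
  fix \<alpha> :: real and \<gamma> :: "nat set \<Rightarrow> real"
  assume \<alpha>: "\<alpha> > 1/2" and \<gamma>: "positive_weights \<gamma>"
  show "\<exists>z \<in> {1..d} \<rightarrow>\<^sub>E {0..<int (\<Prod>p\<in>primes_half n. p)}. \<forall>lam\<in>{1/2..<\<alpha>}.
      ran_error d \<alpha> \<gamma> (ran_lattice_rule d n z) \<le> ennreal (error_bound (40000 * 8 powr (2 * lam)) d \<alpha> \<gamma> n lam)"
    if "n \<ge> 2" for d n
    using \<alpha> \<gamma> that by (intro korobov.exists_generating_vector korobov.intro)
  show "filterlim (\<lambda>lam. korobov_mu d \<alpha> \<gamma> lam) at_top (at_left \<alpha>)" if "d \<ge> 1" for d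
    using \<gamma> \<alpha> that by (rule korobov_mu_filterlim)
  fix lam and n :: nat
  assume lam: "lam \<in> {1/2..<\<alpha>}" and "n \<ge> 2"
    and sum: "(\<lambda>u. \<gamma> u powr (1/lam) * (2 * real_zeta (\<alpha>/lam)) ^ card u)
      summable_on {u. finite u \<and> u \<noteq> {} \<and> u \<subseteq> {1..}}"
  then obtain M where M: "\<And>d. korobov_mu d \<alpha> \<gamma> lam \<le> M"
    using korobov_mu_bounded_dim[OF \<gamma> _ sum] by auto
  \<comment> \<open>The dimension enters the bound only through \<open>korobov_mu\<close>, and
    \<open>powr\<close> with the positive exponent \<open>lam\<close> is monotone on nonnegative
    bases.\<close>
  have "error_bound (40000 * 8 powr (2 * lam)) d \<alpha> \<gamma> n lam
      \<le> sqrt (40000 * 8 powr (2 * lam) * ln (real n)) / real n powr (lam + 1/2) * M powr lam" for d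
    unfolding error_bound_def using M[of d] korobov_mu_nonneg lam \<open>n \<ge> 2\<close>
    by (intro mult_left_mono powr_mono2 divide_nonneg_nonneg) auto
  then show "\<exists>B. \<forall>d\<ge>1. error_bound (40000 * 8 powr (2 * lam)) d \<alpha> \<gamma> n lam \<le> B" by blast
qed simp

end
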